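(* Let $\mathcal Y:\mathcal H\to(-\infty,+\infty]$ be proper, lower semicontinuous and convex, $\gamma>0$, $0<\alpha<2$. Consider the exact and discrete Douglas–Rachford auxiliary sequences of the context with the same $\gamma,\alpha$, and set $\overline e^{(k)}=\|\overline{\mathbf z}^{(k)}-\mathcal J_h\overline{\mathbf z}_h^{(k)}\|_{\mathcal H}$. Then for every $K\geq 0$ $$\overline e^{(K)}\le\overline e^{(0)}+\alpha\sum_{k=0}^{K-1}\bigl(3\pi_h^{(k)}+q_h^{(k)}\bigr),\qquad\|\mathbf z^{(K)}-\mathcal J_h\mathbf z_h^{(K)}\|_{\mathcal H}\le\overline e^{(K)}+\pi_h^{(K)}.$$
   Context: **Continuous setting.** $(\mathcal M,g)$ is a compact, connected, oriented $C^3$ two-dimensional surface without boundary embedded in $\mathbb R^3$; $\mathcal Q=(0,1)\times\mathcal M$; $\mathcal H=L^2(\mathcal Q)\times L^2(\mathcal Q;T\mathcal M)$ with $\|(\rho,\mathbf m)\|_{\mathcal H}^2=\|\rho\|_{L^2}^2+\|\mathbf m\|_{L^2}^2$. $\rho_0,\rho_1\in L^2(\mathcal M)$ are nonnegative with integral one. $\mathcal C$ is the nonempty closed affine set of $(\rho,\mathbf m)\in\mathcal H$ with $(\rho,\partial_t\psi)_{\mathcal Q}+(\mathbf m,\nabla_g\psi)_{\mathcal Q}=(\rho_1,\psi(1))_{L^2(\mathcal M)}-(\rho_0,\psi(0))_{L^2(\mathcal M)}$ for all $\psi\in H^1(\mathcal Q)$. $P=P_{\mathcal C}$ is the orthogonal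 projection onto $\mathcal C$ and $Q_\gamma=\operatorname{Prox}_{\gamma\mathcal Y}$, i.e. $Q_\gamma\mathbf z=\operatorname{argmin}_{\mathbf y}\{\mathcal Y(\mathbf y)+\frac1{2\gamma}\|\mathbf y-\mathbf z\|_{\mathcal H}^2\}$. In the application, $\mathcal Y(\rho,\mathbf m)=\int_0^1\int_{\mathcal M}L(\rho,\mathbf m)+\int_0^1\mathcal F(\rho(t,\cdot))\,dt$, with $\mathcal F(\rho)=\int_{\mathcal M}F_E(x,\rho(x))\,d\sigma_g$ for local interactions. **Exact iteration.** $\overline{\mathbf z}^{(k+1)}=\overline{\mathbf z}^{(k)}+\alpha\bigl[Q_\gamma(2P\overline{\mathbf z}^{(k)}-\overline{\mathbf z}^{(k)})-P\overline{\mathbf z}^{(k)}\bigr]$ and $\mathbf z^{(k)}=P\overline{\mathbf z}^{(k)}$, from a given $\overline{\mathbf z}^{(0)}\in\mathcal H$. **Discrete spaces.** $\mathcal M_h\subset\mathbb R^3$ is a connected, shape-regular triangulated approximation of $\mathcal M$ with vertices $V_i$ and bijective geometric correspondence $p_h:\mathcal M_h\to\mathcal M$; $S_h$ is the continuous piecewise linear space on $\mathcal M_h$ with nodal basis $\psi_i$, $A_i=\int_{\mathcal M_h}\psi_i$; $N_t\ge2$, $\tau=1/N_t$, $t_j=j\tau$, $w_0=w_{N_t}=\tau/2$, $w_j=\tau$ otherwise; $S_\tau$ is the continuous piecewise linear space in time with nodal basis $\phi_j$; $Q_h=S_\tau\otimes S_h$, $u_h=\sum_ju_{h,j}\phi_j$.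 $\rho_{0,h},\rho_{1,h}\in S_h$ are discrete endpoint densities of unit mass. Temporal recovery: $(G_\tau u)_0=(-3u_0+4u_1-u_2)/(2\tau)$, $(G_\tau u)_j=(u_{j+1}-u_{j-1})/(2\tau)$ for $1\le j<N_t$, $(G_\tau u)_{N_t}=(3u_{N_t}-4u_{N_t-1}+u_{N_t-2})/(2\tau)$. Spatial recovery: at each $V_i$ a fixed connected vertex patch is projected onto a local plane and, in planar coordinates centred at $V_i$, one least-squares fits a quadratic parametrization $r_i:\mathbb R^2\to\mathbb R^3$ of the patch vertices and a quadratic polynomial $q_i$ to the values of $u_h$ (design matrix of rank six, $J_i=Dr_i(0)$ of rank two); $(G_hu_h)(V_i)=J_i(J_i^\top J_i)^{-1}\nabla q_i(0)$, extended by nodal interpolation, with component matrices $B_x,B_y,B_z$, and $G_h\cdot\mathbf m_h=B_xm_x+B_ym_y+B_zm_z$. $\mathbf n_i$ is a unit normal to the range of $J_i$, $\Pi_i=I-\mathbf n_i\mathbf n_i^\top$. $X_h$ is the space of $(\rho_h,\mathbf m_h)\in Q_h\times(Q_h)^3$ with nodal momenta in $\mathbf n_i^\perp$, with metric $\|\mathbf z_h\|_h^2=\sum_{j,i}w_jA_i(|\rho_{h,ji}|^2+|\mathbf m_{h,ji}|^2)$. $\mathcal J_h:X_h\to\mathcal H$ is the linear lift $u_h\mapsto u_h\circ p_h^{-1}$ for densities, followed for momenta by pointwise orthogonal projection onto $T\mathcal M$. **Discrete maps.** $\widehat P_h\mathbf v_h=\mathcal R_h(\mathbf v_h+(G_\tau\widehat\varphi_h,G_h\widehat\varphi_h))$,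 where $\mathcal R_h$ replaces the density layers at $t_0,t_{N_t}$ by $\rho_{0,h},\rho_{1,h}$ and projects nodal momenta by $\Pi_i$, and $\widehat\varphi_h\in V_h=\{v_h\in Q_h:\sum_jw_j(v_{h,j},1)_{\mathcal M_h}=0\}$ is a possibly inexact solution of: $\mathfrak a_h(\varphi_h,v_h)=\ell_h(\mathbf v_h;v_h)$ for all $v_h\in V_h$, with $$\mathfrak a_h(u_h,v_h)=\sum_{j=1}^{N_t}\tau\Bigl(\tfrac{u_{h,j}-u_{h,j-1}}\tau,\tfrac{v_{h,j}-v_{h,j-1}}\tau\Bigr)_{\mathcal M_h}+\sum_{j=0}^{N_t}w_j(\nabla_{g_h}u_{h,j},\nabla_{g_h}v_{h,j})_{\mathcal M_h},$$ and, for a pair $(\rho_h,\mathbf m_h)$, $\ell_h((\rho_h,\mathbf m_h);v_h)=\sum_jw_j(G_\tau\rho_{h,j}+G_h\cdot\mathbf m_{h,j}+b_{h,j},v_{h,j})_{\mathcal M_h}$, $b_{h,0}=-2(\rho_{0,h}-\rho_{h,0})/\tau$, $b_{h,N_t}=2(\rho_{1,h}-\rho_{h,N_t})/\tau$, $b_{h,j}=0$ otherwise (with $\rho_{h,0},\rho_{h,N_t}$ the first and last time layers of $\rho_h$). Any scalar-solver error is included in $\widehat P_h$. $\widehat Q_{\gamma,h}:X_h\to X_h$ is the (possibly inexactly computed) proximal map $\operatorname{Prox}_{\gamma\mathcal Y_h}$ in the metric $\|\cdot\|_h$ of the discrete energy $\mathcal Y_h(\mathbf z_h)=\sum_{j,i}w_jA_i[L(\rho_{h,ji},\mathbf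 m_{h,ji})+F_E(V_i,\rho_{h,ji})]$ (interaction part replaced by a corresponding discretization if $\mathcal F$ is nonlocal). **Discrete iteration.** From $\overline{\mathbf z}_h^{(0)}\in X_h$: $\mathbf z_h^{(k)}=\widehat P_h\overline{\mathbf z}_h^{(k)}$, $\mathbf v_h^{(k)}=2\mathbf z_h^{(k)}-\overline{\mathbf z}_h^{(k)}$, $\overline{\mathbf z}_h^{(k+1)}=\overline{\mathbf z}_h^{(k)}+\alpha(\widehat Q_{\gamma,h}\mathbf v_h^{(k)}-\mathbf z_h^{(k)})$. **Defects.** $\pi_h^{(k)}=\|\mathcal J_h\widehat P_h\overline{\mathbf z}_h^{(k)}-P(\mathcal J_h\overline{\mathbf z}_h^{(k)})\|_{\mathcal H}$ and $q_h^{(k)}=\|\mathcal J_h\widehat Q_{\gamma,h}\mathbf v_h^{(k)}-Q_\gamma(\mathcal J_h\mathbf v_h^{(k)})\|_{\mathcal H}$. *)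

theory Defs
  imports "HOL-Analysis.Analysis"
begin

type_synonym R3 = "real^3"
type_synonym point = "real \<times> R3"            \<comment> \<open>\<open>(t, x)\<close> with \<open>x\<close> on the surface\<close>
type_synonym state = "point \<Rightarrow> real \<times> R3"    \<comment> \<open>\<open>(\<rho>, m)\<close>\<close>


section \<open>The surface\<close>

text \<open>Only used on open sets of a finite-dimensional space, where all iterated directional
  derivatives existing and being continuous is the usual notion of class \<open>C\<^sup>k\<close>.\<close>

primrec Ck_on :: "nat \<Rightarrow> ('a::real_normed_vector \<Rightarrow> 'b::real_normed_vector) \<Rightarrow> 'a set \<Rightarrow> bool" where
  "Ck_on 0 f U \<longleftrightarrow> continuous_on U f"
| "Ck_on (Suc k) f U \<longleftrightarrow> (\<forall>x\<in>U. f differentiable at x) \<and>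
     (\<forall>v. Ck_on k (\<lambda>x. frechet_derivative f (at x) v) U)"

text \<open>A surface together with its orientation, given as a unit normal field, and its area measure.\<close>

record surface =
  S_set :: "R3 set"
  S_nu :: "R3 \<Rightarrow> R3"
  S_area :: "R3 measure"

definition local_param :: "R3 set \<Rightarrow> (real^2) set \<Rightarrow> (real^2 \<Rightarrow> R3) \<Rightarrow> bool" where
  "local_param M U X \<longleftrightarrow> open U \<and> Ck_on 3 X U \<and>
     (\<forall>u\<in>U. inj (frechet_derivative X (at u))) \<and>
     openin (top_of_set M) (X ` U) \<and> (\<exists>Y. homeomorphism U (X ` U) X Y)"

definition metric_tensor :: "(real^2 \<Rightarrow> R3) \<Rightarrow> real^2 \<Rightarrow> real^2^2" where
  "metric_tensor X u = (\<chi> i j. frechet_derivative X (at u) (axis i 1) \<bullet>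
                                frechet_derivative X (at u) (axis j 1))"

text \<open>The last conjunct is \<open>d\<sigma>\<^sub>g = sqrt (det g) du\<close> in local coordinates, which determines the
  measure since countably many coordinate patches cover the surface.\<close>

definition closed_surface :: "surface \<Rightarrow> bool" where
  "closed_surface S \<longleftrightarrow>
     S_set S \<noteq> {} \<and> compact (S_set S) \<and> connected (S_set S) \<and>
     (\<forall>x\<in>S_set S. \<exists>U X. local_param (S_set S) U X \<and> x \<in> X ` U) \<and>
     continuous_on (S_set S) (S_nu S) \<and> (\<forall>x\<in>S_set S. norm (S_nu S x) = 1) \<and>
     (\<forall>U X. local_param (S_set S) U X \<longrightarrow>
        (\<forall>u\<in>U. \<forall>v. S_nu S (X u) \<bullet> frechet_derivative X (at u) v = 0)) \<and>
     sets (S_area S) = sets (restrict_space borel (S_set S)) \<and>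
     (\<forall>U X. local_param (S_set S) U X \<longrightarrow>
        (\<forall>B\<in>sets borel. B \<subseteq> U \<longrightarrow>
           emeasure (S_area S) (X ` B) =
             (\<integral>\<^sup>+u. indicator B u * ennreal (sqrt (det (metric_tensor X u))) \<partial>lborel)))"

text \<open>Orthogonal projection onto the tangent plane at \<open>x\<close>, the orthogonal complement of the
  unit normal.\<close>

definition tan_proj :: "surface \<Rightarrow> R3 \<Rightarrow> R3 \<Rightarrow> R3" where
  "tan_proj S x v = v - (v \<bullet> S_nu S x) *\<^sub>R S_nu S x"

definition cyl :: "surface \<Rightarrow> point measure" where
  "cyl S = restrict_space lborel {0<..<1} \<Otimes>\<^sub>M S_area S"


section \<open>Square-integrable functions and the Hilbert space\<close>

text \<open>Elements of Lebesgue spaces are represented by functions; equality in the space is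
  equality almost everywhere, and the norms below are seminorms on representatives.\<close>

definition L2 :: "'a measure \<Rightarrow> ('a \<Rightarrow> 'b::euclidean_space) set" where
  "L2 N = {f \<in> borel_measurable N. integrable N (\<lambda>x. (norm (f x))\<^sup>2)}"

definition L2_inner :: "'a measure \<Rightarrow> ('a \<Rightarrow> 'b::euclidean_space) \<Rightarrow> ('a \<Rightarrow> 'b) \<Rightarrow> real" where
  "L2_inner N f g = (LINT x|N. f x \<bullet> g x)"

definition L2_norm :: "'a measure \<Rightarrow> ('a \<Rightarrow> 'b::euclidean_space) \<Rightarrow> real" where
  "L2_norm N f = sqrt (LINT x|N. (norm (f x))\<^sup>2)"

definition tangential :: "surface \<Rightarrow> (point \<Rightarrow> R3) \<Rightarrow> bool" where
  "tangential S m \<longleftrightarrow> (AE q in cyl S. m q \<bullet> S_nu S (snd q) = 0)"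

definition HH :: "surface \<Rightarrow> state set" where
  "HH S = {z. fst \<circ> z \<in> L2 (cyl S) \<and> snd \<circ> z \<in> L2 (cyl S) \<and> tangential S (snd \<circ> z)}"

definition normH :: "surface \<Rightarrow> state \<Rightarrow> real" where
  "normH S z = sqrt ((L2_norm (cyl S) (fst \<circ> z))\<^sup>2 + (L2_norm (cyl S) (snd \<circ> z))\<^sup>2)"

definition eqH :: "surface \<Rightarrow> state \<Rightarrow> state \<Rightarrow> bool" where
  "eqH S y z \<longleftrightarrow> (AE q in cyl S. y q = z q)"


section \<open>The continuity equation\<close>

definition dt :: "(point \<Rightarrow> real) \<Rightarrow> point \<Rightarrow> real" where
  "dt \<psi> q = frechet_derivative \<psi> (at q) (1, 0)"

definition surf_grad :: "surface \<Rightarrow> (point \<Rightarrow> real) \<Rightarrow> point \<Rightarrow> R3" where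
  "surf_grad S \<psi> q = tan_proj S (snd q) (\<Sum>b\<in>Basis. frechet_derivative \<psi> (at q) (0, b) *\<^sub>R b)"

text \<open>\<open>\<psi>\<close> lies in \<open>H\<^sup>1\<close> of the space-time cylinder, with weak derivatives \<open>d\<close>, \<open>g\<close> and traces
  \<open>\<psi>0\<close>, \<open>\<psi>1\<close> at \<open>t = 0, 1\<close>. The space is taken as the completion of \<open>C\<^sup>1\<close> of the closed cylinder
  (every such function extends to a \<open>C\<^sup>1\<close> function on the ambient space), and the trace as the
  continuous extension of restriction.\<close>

definition H1 :: "surface \<Rightarrow> (point \<Rightarrow> real) \<Rightarrow> (point \<Rightarrow> real) \<Rightarrow> (point \<Rightarrow> R3) \<Rightarrow>
    (R3 \<Rightarrow> real) \<Rightarrow> (R3 \<Rightarrow> real) \<Rightarrow> bool" where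
  "H1 S \<psi> d g \<psi>0 \<psi>1 \<longleftrightarrow>
     \<psi> \<in> L2 (cyl S) \<and> d \<in> L2 (cyl S) \<and> g \<in> L2 (cyl S) \<and> tangential S g \<and>
     \<psi>0 \<in> L2 (S_area S) \<and> \<psi>1 \<in> L2 (S_area S) \<and>
     (\<exists>s. (\<forall>n. Ck_on 1 (s n) UNIV) \<and>
        (\<lambda>n. L2_norm (cyl S) (\<lambda>q. s n q - \<psi> q)) \<longlonglongrightarrow> 0 \<and>
        (\<lambda>n. L2_norm (cyl S) (\<lambda>q. dt (s n) q - d q)) \<longlonglongrightarrow> 0 \<and>
        (\<lambda>n. L2_norm (cyl S) (\<lambda>q. surf_grad S (s n) q - g q)) \<longlonglongrightarrow> 0 \<and>
        (\<lambda>n. L2_norm (S_area S) (\<lambda>x. s n (0, x) - \<psi>0 x)) \<longlonglongrightarrow> 0 \<and>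
        (\<lambda>n. L2_norm (S_area S) (\<lambda>x. s n (1, x) - \<psi>1 x)) \<longlonglongrightarrow> 0)"

definition endpoint_density :: "surface \<Rightarrow> (R3 \<Rightarrow> real) \<Rightarrow> bool" where
  "endpoint_density S r \<longleftrightarrow> r \<in> L2 (S_area S) \<and> (AE x in S_area S. 0 \<le> r x) \<and>
     (LINT x|S_area S. r x) = 1"

definition CC :: "surface \<Rightarrow> (R3 \<Rightarrow> real) \<Rightarrow> (R3 \<Rightarrow> real) \<Rightarrow> state set" where
  "CC S \<rho>0 \<rho>1 = {z \<in> HH S. \<forall>\<psi> d g \<psi>0 \<psi>1. H1 S \<psi> d g \<psi>0 \<psi>1 \<longrightarrow>
     L2_inner (cyl S) (fst \<circ> z) d + L2_inner (cyl S) (snd \<circ> z) g =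
     L2_inner (S_area S) \<rho>1 \<psi>1 - L2_inner (S_area S) \<rho>0 \<psi>0}"


section \<open>Projection, proximal map and the exact step\<close>

definition proj :: "surface \<Rightarrow> state set \<Rightarrow> state \<Rightarrow> state" where
  "proj S C z = arg_min (\<lambda>y. normH S (\<lambda>q. z q - y q)) (\<lambda>y. y \<in> C)"

definition prox :: "surface \<Rightarrow> real \<Rightarrow> (state \<Rightarrow> ereal) \<Rightarrow> state \<Rightarrow> state" where
  "prox S \<gamma> Y z =
     arg_min (\<lambda>y. Y y + ereal (1 / (2 * \<gamma>) * (normH S (\<lambda>q. y q - z q))\<^sup>2)) (\<lambda>y. y \<in> HH S)"

definition properH :: "surface \<Rightarrow> (state \<Rightarrow> ereal) \<Rightarrow> bool" where
  "properH S Y \<longleftrightarrow> (\<forall>z\<in>HH S. Y z \<noteq> -\<infinity>) \<and> (\<exists>z\<in>HH S. Y z \<noteq> \<infinity>)"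

text \<open>Lower semicontinuity for the seminorm also forces \<open>Y\<close> to take equal values on
  representatives that agree almost everywhere.\<close>

definition lscH :: "surface \<Rightarrow> (state \<Rightarrow> ereal) \<Rightarrow> bool" where
  "lscH S Y \<longleftrightarrow> (\<forall>y\<in>HH S. \<forall>a < Y y. \<exists>\<delta>>0. \<forall>z\<in>HH S.
     normH S (\<lambda>q. z q - y q) < \<delta> \<longrightarrow> a < Y z)"

definition convexH :: "surface \<Rightarrow> (state \<Rightarrow> ereal) \<Rightarrow> bool" where
  "convexH S Y \<longleftrightarrow> (\<forall>y\<in>HH S. \<forall>z\<in>HH S. \<forall>\<theta>::real. 0 \<le> \<theta> \<and> \<theta> \<le> 1 \<longrightarrow>
     Y (\<lambda>q. (1 - \<theta>) *\<^sub>R y q + \<theta> *\<^sub>R z q) \<le> ereal (1 - \<theta>) * Y y + ereal \<theta> * Y z)"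

definition DR_step :: "real \<Rightarrow> (state \<Rightarrow> state) \<Rightarrow> (state \<Rightarrow> state) \<Rightarrow> state \<Rightarrow> state" where
  "DR_step \<alpha> P Q z = (\<lambda>q. z q + \<alpha> *\<^sub>R (Q (\<lambda>q'. 2 *\<^sub>R P z q' - z q') q - P z q))"


section \<open>The mesh\<close>

text \<open>The vertices are indexed by a finite type. A triangle is a triple of vertex indices; the
  order of the corners is immaterial and each triangle is listed once. \<open>D_e1\<close>, \<open>D_e2\<close> span the
  local plane used for gradient recovery at a vertex.\<close>

record 'v discretization =
  D_vert :: "'v \<Rightarrow> R3"
  D_tri :: "('v \<times> 'v \<times> 'v) set"
  D_ph :: "R3 \<Rightarrow> R3"
  D_patch :: "'v \<Rightarrow> 'v set"
  D_e1 :: "'v \<Rightarrow> R3"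
  D_e2 :: "'v \<Rightarrow> R3"
  D_nrm :: "'v \<Rightarrow> R3"
  D_steps :: nat
  D_rho0 :: "'v \<Rightarrow> real"
  D_rho1 :: "'v \<Rightarrow> real"

type_synonym 'v scalar_h = "nat \<Rightarrow> 'v \<Rightarrow> real"         \<comment> \<open>nodal values at time layer \<open>j\<close>, vertex \<open>i\<close>\<close>
type_synonym 'v state_h = "nat \<Rightarrow> 'v \<Rightarrow> real \<times> R3"

fun corners :: "'v \<times> 'v \<times> 'v \<Rightarrow> 'v set" where
  "corners (a, b, c) = {a, b, c}"

definition cell :: "'v discretization \<Rightarrow> 'v \<times> 'v \<times> 'v \<Rightarrow> R3 set" where
  "cell D K = convex hull (D_vert D ` corners K)"

definition mesh_set :: "'v discretization \<Rightarrow> R3 set" where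
  "mesh_set D = (\<Union>K\<in>D_tri D. cell D K)"

definition triangulated :: "'v::finite discretization \<Rightarrow> bool" where
  "triangulated D \<longleftrightarrow>
     inj (D_vert D) \<and>
     (\<forall>K\<in>D_tri D. card (corners K) = 3 \<and> \<not> affine_dependent (D_vert D ` corners K)) \<and>
     inj_on corners (D_tri D) \<and>
     (\<forall>K\<in>D_tri D. \<forall>K'\<in>D_tri D.
        cell D K \<inter> cell D K' = convex hull (D_vert D ` (corners K \<inter> corners K'))) \<and>
     (\<Union>K\<in>D_tri D. corners K) = UNIV"

definition inradius :: "R3 set \<Rightarrow> real" where
  "inradius K = Sup {r. 0 \<le> r \<and> (\<exists>c\<in>K. cball c r \<inter> affine hull K \<subseteq> K)}"

definition shape_regular :: "real \<Rightarrow> 'v discretization \<Rightarrow> bool" where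
  "shape_regular \<kappa> D \<longleftrightarrow> (\<forall>K\<in>D_tri D. diameter (cell D K) \<le> \<kappa> * inradius (cell D K))"

text \<open>Measurability of the inverse is the only regularity needed for the lift to make sense.\<close>

definition correspondence :: "surface \<Rightarrow> 'v discretization \<Rightarrow> bool" where
  "correspondence S D \<longleftrightarrow> bij_betw (D_ph D) (mesh_set D) (S_set S) \<and>
     the_inv_into (mesh_set D) (D_ph D) \<in> borel_measurable (S_area S)"

text \<open>\<open>hat D i\<close> is the nodal basis function of vertex \<open>i\<close>: on a triangle it is the barycentric
  coordinate belonging to that vertex.\<close>

definition bary :: "'v::finite discretization \<Rightarrow> R3 \<Rightarrow> 'v \<Rightarrow> real" where
  "bary D x = (THE l. (\<forall>i. 0 \<le> l i) \<and> (\<exists>K\<in>D_tri D. \<forall>i. i \<notin> corners K \<longrightarrow> l i = 0) \<and>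
     (\<Sum>i\<in>UNIV. l i) = 1 \<and> (\<Sum>i\<in>UNIV. l i *\<^sub>R D_vert D i) = x)"

definition hat :: "'v::finite discretization \<Rightarrow> 'v \<Rightarrow> R3 \<Rightarrow> real" where
  "hat D i x = bary D x i"

definition interp :: "'v::finite discretization \<Rightarrow> ('v \<Rightarrow> 'b::real_vector) \<Rightarrow> R3 \<Rightarrow> 'b" where
  "interp D u x = (\<Sum>i\<in>UNIV. hat D i x *\<^sub>R u i)"

text \<open>Surface integral over a triangle, by its affine parametrization over the unit triangle.\<close>

fun cell_integral :: "'v discretization \<Rightarrow> 'v \<times> 'v \<times> 'v \<Rightarrow> (R3 \<Rightarrow> real) \<Rightarrow> real" where
  "cell_integral D (a, b, c) f =
     (let A = D_vert D a; p = D_vert D b - A; q = D_vert D c - A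
      in norm (cross3 p q) *
         (LINT w:{(s, t). 0 \<le> s \<and> 0 \<le> t \<and> s + t \<le> 1}|lborel. f (A + fst w *\<^sub>R p + snd w *\<^sub>R q)))"

definition mesh_integral :: "'v discretization \<Rightarrow> (R3 \<Rightarrow> real) \<Rightarrow> real" where
  "mesh_integral D f = (\<Sum>K\<in>D_tri D. cell_integral D K f)"

definition mesh_inner :: "'v::finite discretization \<Rightarrow> ('v \<Rightarrow> real) \<Rightarrow> ('v \<Rightarrow> real) \<Rightarrow> real" where
  "mesh_inner D u v = mesh_integral D (\<lambda>x. interp D u x * interp D v x)"

definition node_area :: "'v::finite discretization \<Rightarrow> 'v \<Rightarrow> real" where
  "node_area D i = mesh_integral D (hat D i)"

definition unit_mass :: "'v::finite discretization \<Rightarrow> ('v \<Rightarrow> real) \<Rightarrow> bool" where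
  "unit_mass D r \<longleftrightarrow> mesh_integral D (interp D r) = 1"

fun cell_grad :: "'v discretization \<Rightarrow> ('v \<Rightarrow> real) \<Rightarrow> 'v \<times> 'v \<times> 'v \<Rightarrow> R3" where
  "cell_grad D u (a, b, c) =
     (let p = D_vert D b - D_vert D a; q = D_vert D c - D_vert D a
      in THE g. g \<in> span {p, q} \<and> g \<bullet> p = u b - u a \<and> g \<bullet> q = u c - u a)"

definition mesh_grad_inner :: "'v discretization \<Rightarrow> ('v \<Rightarrow> real) \<Rightarrow> ('v \<Rightarrow> real) \<Rightarrow> real" where
  "mesh_grad_inner D u v =
     (\<Sum>K\<in>D_tri D. cell_integral D K (\<lambda>x. cell_grad D u K \<bullet> cell_grad D v K))"


section \<open>Time discretization\<close>

definition tau :: "'v discretization \<Rightarrow> real" where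
  "tau D = 1 / real (D_steps D)"

definition wt :: "'v discretization \<Rightarrow> nat \<Rightarrow> real" where
  "wt D j = (if j = 0 \<or> j = D_steps D then tau D / 2 else tau D)"

definition time_hat :: "'v discretization \<Rightarrow> nat \<Rightarrow> real \<Rightarrow> real" where
  "time_hat D j t = max 0 (1 - \<bar>t - real j * tau D\<bar> / tau D)"

definition G_tau :: "'v discretization \<Rightarrow> 'v scalar_h \<Rightarrow> 'v scalar_h" where
  "G_tau D u j i = (let N = D_steps D; \<tau> = tau D in
     if j = 0 then (- 3 * u 0 i + 4 * u 1 i - u 2 i) / (2 * \<tau>)
     else if j < N then (u (j + 1) i - u (j - 1) i) / (2 * \<tau>)
     else if j = N then (3 * u N i - 4 * u (N - 1) i + u (N - 2) i) / (2 * \<tau>)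
     else 0)"


section \<open>Spatial gradient recovery\<close>

definition monomials :: "real \<Rightarrow> real \<Rightarrow> real^6" where
  "monomials x y = vector [1, x, y, x\<^sup>2, x * y, y\<^sup>2]"

definition design_row :: "'v discretization \<Rightarrow> 'v \<Rightarrow> 'v \<Rightarrow> real^6" where
  "design_row D i j = monomials ((D_vert D j - D_vert D i) \<bullet> D_e1 D i)
                                ((D_vert D j - D_vert D i) \<bullet> D_e2 D i)"

text \<open>Coefficients of the least-squares quadratic fit on the patch of \<open>i\<close>; its gradient at the
  origin consists of the coefficients of the two linear monomials.\<close>

definition lsq_fit :: "'v discretization \<Rightarrow> 'v \<Rightarrow> ('v \<Rightarrow> real) \<Rightarrow> real^6" where
  "lsq_fit D i u = arg_min (\<lambda>c. \<Sum>j\<in>D_patch D i. (c \<bullet> design_row D i j - u j)\<^sup>2) (\<lambda>_. True)"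

definition fit_grad :: "'v discretization \<Rightarrow> 'v \<Rightarrow> ('v \<Rightarrow> real) \<Rightarrow> real^2" where
  "fit_grad D i u = vector [lsq_fit D i u $ 2, lsq_fit D i u $ 3]"

definition Jac :: "'v discretization \<Rightarrow> 'v \<Rightarrow> real^2^3" where
  "Jac D i = (\<chi> a b. fit_grad D i (\<lambda>j. D_vert D j $ a) $ b)"

definition G_sp :: "'v discretization \<Rightarrow> ('v \<Rightarrow> real) \<Rightarrow> 'v \<Rightarrow> R3" where
  "G_sp D u i = (let J = Jac D i in
     (J ** matrix_inv (transpose J ** J)) *v fit_grad D i u)"

definition B_mat :: "'v discretization \<Rightarrow> 3 \<Rightarrow> 'v \<Rightarrow> 'v \<Rightarrow> real" where
  "B_mat D a i k = G_sp D (\<lambda>l. if l = k then 1 else 0) i $ a"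

definition div_h :: "'v::finite discretization \<Rightarrow> ('v \<Rightarrow> R3) \<Rightarrow> 'v \<Rightarrow> real" where
  "div_h D m i = (\<Sum>a\<in>UNIV. \<Sum>k\<in>UNIV. B_mat D a i k * m k $ a)"

definition mesh_edges :: "'v discretization \<Rightarrow> ('v \<times> 'v) set" where
  "mesh_edges D = {(j, k). \<exists>K\<in>D_tri D. j \<in> corners K \<and> k \<in> corners K}"

definition recovery_data :: "'v::finite discretization \<Rightarrow> bool" where
  "recovery_data D \<longleftrightarrow> (\<forall>i.
     i \<in> D_patch D i \<and>
     (\<forall>j\<in>D_patch D i. (i, j) \<in> (mesh_edges D \<inter> D_patch D i \<times> D_patch D i)\<^sup>*) \<and>
     norm (D_e1 D i) = 1 \<and> norm (D_e2 D i) = 1 \<and> D_e1 D i \<bullet> D_e2 D i = 0 \<and>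
     dim (design_row D i ` D_patch D i) = 6 \<and>
     rank (Jac D i) = 2 \<and>
     norm (D_nrm D i) = 1 \<and> (\<forall>w. D_nrm D i \<bullet> (Jac D i *v w) = 0))"

definition Pi_h :: "'v discretization \<Rightarrow> 'v \<Rightarrow> R3 \<Rightarrow> R3" where
  "Pi_h D i v = v - (v \<bullet> D_nrm D i) *\<^sub>R D_nrm D i"


section \<open>Discrete spaces and the lift\<close>

text \<open>Arrays of nodal values are extended by zero past the last time layer.\<close>

definition Qh :: "'v discretization \<Rightarrow> 'v scalar_h set" where
  "Qh D = {u. \<forall>j>D_steps D. \<forall>i. u j i = 0}"

definition Vh :: "'v::finite discretization \<Rightarrow> 'v scalar_h set" where
  "Vh D = {v \<in> Qh D. (\<Sum>j\<le>D_steps D. wt D j * mesh_inner D (v j) (\<lambda>_. 1)) = 0}"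

definition Xh :: "'v discretization \<Rightarrow> 'v state_h set" where
  "Xh D = {z. (\<forall>j>D_steps D. \<forall>i. z j i = 0) \<and> (\<forall>j i. snd (z j i) \<bullet> D_nrm D i = 0)}"

definition norm_h :: "'v::finite discretization \<Rightarrow> 'v state_h \<Rightarrow> real" where
  "norm_h D z = sqrt (\<Sum>j\<le>D_steps D. \<Sum>i\<in>UNIV.
     wt D j * node_area D i * (\<bar>fst (z j i)\<bar>\<^sup>2 + (norm (snd (z j i)))\<^sup>2))"

definition eval_h :: "'v::finite discretization \<Rightarrow> (nat \<Rightarrow> 'v \<Rightarrow> 'b::real_vector) \<Rightarrow> point \<Rightarrow> 'b" where
  "eval_h D u q = (\<Sum>j\<le>D_steps D. time_hat D j (fst q) *\<^sub>R interp D (u j) (snd q))"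

definition Jh :: "surface \<Rightarrow> 'v::finite discretization \<Rightarrow> 'v state_h \<Rightarrow> state" where
  "Jh S D z q = (let y = (fst q, the_inv_into (mesh_set D) (D_ph D) (snd q)) in
     (eval_h D (\<lambda>j i. fst (z j i)) y,
      tan_proj S (snd q) (eval_h D (\<lambda>j i. snd (z j i)) y)))"


section \<open>Discrete projection and proximal map\<close>

definition a_h :: "'v::finite discretization \<Rightarrow> 'v scalar_h \<Rightarrow> 'v scalar_h \<Rightarrow> real" where
  "a_h D u v =
     (\<Sum>j=1..D_steps D. tau D * mesh_inner D (\<lambda>i. (u j i - u (j - 1) i) / tau D)
                                            (\<lambda>i. (v j i - v (j - 1) i) / tau D)) +
     (\<Sum>j\<le>D_steps D. wt D j * mesh_grad_inner D (u j) (v j))"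

definition b_h :: "'v discretization \<Rightarrow> 'v state_h \<Rightarrow> 'v scalar_h" where
  "b_h D z j i = (if j = 0 then - 2 * (D_rho0 D i - fst (z 0 i)) / tau D
     else if j = D_steps D then 2 * (D_rho1 D i - fst (z j i)) / tau D
     else 0)"

definition ell_h :: "'v::finite discretization \<Rightarrow> 'v state_h \<Rightarrow> 'v scalar_h \<Rightarrow> real" where
  "ell_h D z v = (\<Sum>j\<le>D_steps D. wt D j *
     mesh_inner D (\<lambda>i. G_tau D (\<lambda>j i. fst (z j i)) j i + div_h D (\<lambda>i. snd (z j i)) i + b_h D z j i)
                  (v j))"

definition R_h :: "'v discretization \<Rightarrow> 'v state_h \<Rightarrow> 'v state_h" where
  "R_h D z j i = (if j > D_steps D then 0 else
     (if j = 0 then D_rho0 D i else if j = D_steps D then D_rho1 D i else fst (z j i),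
      Pi_h D i (snd (z j i))))"

text \<open>\<open>\<Phi>\<close> maps a discrete state to the (possibly inexact) potential returned by the solver.\<close>

definition P_hat :: "'v discretization \<Rightarrow> ('v state_h \<Rightarrow> 'v scalar_h) \<Rightarrow> 'v state_h \<Rightarrow> 'v state_h" where
  "P_hat D \<Phi> v = R_h D (\<lambda>j i. v j i + (G_tau D (\<Phi> v) j i, G_sp D (\<Phi> v j) i))"

text \<open>\<open>E\<close> is the discrete interaction energy. For a local interaction with density \<open>F\<close> it is
  \<open>E \<rho> = (\<Sum>j\<le>D_steps D. \<Sum>i\<in>UNIV. ereal (wt D j * node_area D i) * F (D_vert D i) (\<rho> j i))\<close>; for a nonlocal
  interaction it is any discretization.\<close>

definition energy_h :: "'v::finite discretization \<Rightarrow> (real \<Rightarrow> R3 \<Rightarrow> ereal) \<Rightarrow> ('v scalar_h \<Rightarrow> ereal) \<Rightarrow>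
    'v state_h \<Rightarrow> ereal" where
  "energy_h D L E z =
     (\<Sum>j\<le>D_steps D. \<Sum>i\<in>UNIV. ereal (wt D j * node_area D i) * L (fst (z j i)) (snd (z j i))) +
     E (\<lambda>j i. fst (z j i))"

definition prox_h :: "'v::finite discretization \<Rightarrow> real \<Rightarrow> ('v state_h \<Rightarrow> ereal) \<Rightarrow>
    'v state_h \<Rightarrow> 'v state_h" where
  "prox_h D \<gamma> Y z =
     arg_min (\<lambda>y. Y y + ereal (1 / (2 * \<gamma>) * (norm_h D (\<lambda>j i. y j i - z j i))\<^sup>2)) (\<lambda>y. y \<in> Xh D)"

end

theory Submission
  imports Defs
begin

text \<open>
  The projection and the proximal map are both minimizers of a proper, lower semicontinuous, convex
  function plus a multiple of the squared distance; completeness of \<open>L\<^sup>2\<close> gives existence, and the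
  variational inequality gives firm nonexpansiveness. Hence the reflections \<open>2P - I\<close> and \<open>2Q - I\<close>
  are nonexpansive, and so is the Douglas--Rachford step for \<open>0 < \<alpha> < 2\<close>. A discrete step, lifted to
  the continuous space by the linear map \<open>J\<^sub>h\<close>, is an exact step with a perturbed \<open>P\<close> and \<open>Q\<close>:
  the defect of \<open>P\<close> enters twice through the argument of \<open>Q\<close> and once directly. The errors
  therefore accumulate additively. That lifted states are square integrable needs the surface to
  have finite area and the nodal basis functions to be continuous on the mesh.
\<close>

section \<open>Square-integrable functions\<close>

text \<open>Points of the space are functions rather than classes, and \<open>proj\<close> and
  \<open>prox\<close> return some minimizer picked by choice. No uniqueness is therefore invoked:
  existence makes the choice a genuine minimizer, and every selection of minimizers is firmly
  nonexpansive for the seminorm. The price is that membership in \<open>L2\<close> has to be tracked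
  throughout: the integral of a non-integrable function is 0 by convention, so
  \<open>L2_norm\<close> would vanish on functions that are far from 0. Density and momentum are
  treated as one function with values in \<open>real \<times> R3\<close>, which makes
  \<open>HH S\<close> a closed subspace of a single \<open>L2\<close> space. Two errors are compared
  through the exact step taken from the lifted discrete iterate, because the defects are measured
  there. The old error is then carried over with factor 1, so no constant grows with the number of
  steps.\<close>

lemma L2_measurable [measurable_dest]: "f \<in> L2 N \<Longrightarrow> f \<in> borel_measurable N"
  by (simp add: L2_def)

lemma L2_integrable: "f \<in> L2 N \<Longrightarrow> integrable N (\<lambda>x. (norm (f x))\<^sup>2)"
  by (simp add: L2_def)

lemma L2I_le:
  assumes "f \<in> borel_measurable N" and "integrable N h" and "\<And>x. (norm (f x))\<^sup>2 \<le> h x"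
  shows "f \<in> L2 N"
  using assms unfolding L2_def
  by (auto intro!: Bochner_Integration.integrable_bound[of N h] order_trans[OF assms(3) abs_ge_self])

lemma L2_lincomb:
  fixes f g :: "'a \<Rightarrow> 'b::euclidean_space"
  assumes "f \<in> L2 N" "g \<in> L2 N"
  shows "(\<lambda>x. a *\<^sub>R f x + b *\<^sub>R g x) \<in> L2 N"
proof (rule L2I_le)
  show "(\<lambda>x. a *\<^sub>R f x + b *\<^sub>R g x) \<in> borel_measurable N"
    using assms[THEN L2_measurable] by measurable
  show "integrable N (\<lambda>x. 2 * (a\<^sup>2 * (norm (f x))\<^sup>2) + 2 * (b\<^sup>2 * (norm (g x))\<^sup>2))"
    using assms[THEN L2_integrable] by simp
  show "(norm (a *\<^sub>R f x + b *\<^sub>R g x))\<^sup>2 \<le> 2 * (a\<^sup>2 * (norm (f x))\<^sup>2) + 2 * (b\<^sup>2 * (norm (g x))\<^sup>2)" for x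
  proof -
    have "(norm (a *\<^sub>R f x + b *\<^sub>R g x))\<^sup>2 \<le> (\<bar>a\<bar> * norm (f x) + \<bar>b\<bar> * norm (g x))\<^sup>2"
      by (intro power_mono norm_triangle_le) auto
    also have "\<dots> \<le> 2 * (\<bar>a\<bar> * norm (f x))\<^sup>2 + 2 * (\<bar>b\<bar> * norm (g x))\<^sup>2"
      using sum_squares_bound[of "\<bar>a\<bar> * norm (f x)" "\<bar>b\<bar> * norm (g x)"]
      by (simp add: power2_sum)
    finally show ?thesis by (simp add: power_mult_distrib)
  qed
qed

lemma L2_diff: "f \<in> L2 N \<Longrightarrow> g \<in> L2 N \<Longrightarrow> (\<lambda>x. f x - g x) \<in> L2 N"
  using L2_lincomb[of f N g 1 "-1"] by simp

lemma L2_scaleR: "f \<in> L2 N \<Longrightarrow> (\<lambda>x. a *\<^sub>R f x) \<in> L2 N"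
  using L2_lincomb[of f N f a 0] by simp

lemma L2_inner_integrable:
  fixes f g :: "'a \<Rightarrow> 'b::euclidean_space"
  assumes "f \<in> L2 N" "g \<in> L2 N"
  shows "integrable N (\<lambda>x. f x \<bullet> g x)"
proof (rule Bochner_Integration.integrable_bound)
  show "integrable N (\<lambda>x. (norm (f x))\<^sup>2 + (norm (g x))\<^sup>2)"
    using assms[THEN L2_integrable] by simp
  show "(\<lambda>x. f x \<bullet> g x) \<in> borel_measurable N"
    using assms[THEN L2_measurable] by measurable
  have "\<bar>f x \<bullet> g x\<bar> \<le> (norm (f x))\<^sup>2 + (norm (g x))\<^sup>2" for x
    using Cauchy_Schwarz_ineq2[of "f x" "g x"] sum_squares_bound[of "norm (f x)" "norm (g x)"]
      zero_le_mult_iff[of "norm (f x)" "norm (g x)"] norm_ge_zero[of "f x"] norm_ge_zero[of "g x"]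
    by linarith
  then show "AE x in N. norm (f x \<bullet> g x) \<le> norm ((norm (f x))\<^sup>2 + (norm (g x))\<^sup>2)"
    by simp
qed

lemma L2_inner_commute: "L2_inner N f g = L2_inner N g f"
  by (simp add: L2_inner_def inner_commute)

lemma L2_inner_lincomb_left:
  assumes "f \<in> L2 N" "g \<in> L2 N" "h \<in> L2 N"
  shows "L2_inner N (\<lambda>x. a *\<^sub>R f x + b *\<^sub>R g x) h = a * L2_inner N f h + b * L2_inner N g h"
  using L2_inner_integrable[OF assms(1,3)] L2_inner_integrable[OF assms(2,3)]
  by (simp add: L2_inner_def inner_add_left)

lemma L2_inner_diff_left:
  assumes "f \<in> L2 N" "g \<in> L2 N" "h \<in> L2 N"
  shows "L2_inner N (\<lambda>x. f x - g x) h = L2_inner N f h - L2_inner N g h"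
  using L2_inner_lincomb_left[OF assms, of 1 "-1"] by simp

lemma L2_norm_nonneg [simp]: "0 \<le> L2_norm N f"
  by (simp add: L2_norm_def)

lemma L2_norm_sq: "(L2_norm N f)\<^sup>2 = L2_inner N f f"
  by (simp add: L2_norm_def L2_inner_def power2_norm_eq_inner)

lemma L2_norm_minus_commute: "L2_norm N (\<lambda>x. f x - g x) = L2_norm N (\<lambda>x. g x - f x)"
  by (simp add: L2_norm_def norm_minus_commute)

lemma L2_norm_scaleR: "L2_norm N (\<lambda>x. a *\<^sub>R f x) = \<bar>a\<bar> * L2_norm N f"
  by (simp add: L2_norm_def power_mult_distrib real_sqrt_mult)

lemma L2_norm_cong_AE:
  assumes "AE x in N. f x = g x" "f \<in> borel_measurable N" "g \<in> borel_measurable N"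
  shows "L2_norm N f = L2_norm N g"
  using assms unfolding L2_norm_def by (intro arg_cong[of _ _ sqrt] integral_cong_AE) auto

lemma L2_norm_lincomb_sq:
  fixes f g :: "'a \<Rightarrow> 'b::euclidean_space"
  assumes "f \<in> L2 N" "g \<in> L2 N"
  shows "(L2_norm N (\<lambda>x. a *\<^sub>R f x + b *\<^sub>R g x))\<^sup>2 =
    a\<^sup>2 * (L2_norm N f)\<^sup>2 + 2 * a * b * L2_inner N f g + b\<^sup>2 * (L2_norm N g)\<^sup>2"
proof -
  note mem = assms L2_lincomb[OF assms, of a b]
  have "L2_inner N f (\<lambda>x. a *\<^sub>R f x + b *\<^sub>R g x) = a * L2_inner N f f + b * L2_inner N f g"
    "L2_inner N g (\<lambda>x. a *\<^sub>R f x + b *\<^sub>R g x) = a * L2_inner N f g + b * L2_inner N g g"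
    using mem by (simp_all add: L2_inner_commute[of N _ "\<lambda>x. a *\<^sub>R f x + b *\<^sub>R g x"]
        L2_inner_lincomb_left L2_inner_commute[of N g f])
  then show ?thesis
    unfolding L2_norm_sq by (simp add: mem L2_inner_lincomb_left power2_eq_square algebra_simps)
qed

text \<open>The quadratic form \<open>pos\<close> is a squared norm. At \<open>a = I\<close>,
  \<open>b = -A^2\<close> it equals \<open>A^2 * (A^2 * B^2 - I^2)\<close>, which settles the case
  of nonzero \<open>A\<close>; for \<open>A = 0\<close> the form is affine in \<open>a\<close> and
  can only stay nonnegative if \<open>I = 0\<close>.\<close>

lemma L2_Cauchy_Schwarz:
  fixes f g :: "'a \<Rightarrow> 'b::euclidean_space"
  assumes "f \<in> L2 N" "g \<in> L2 N"
  shows "\<bar>L2_inner N f g\<bar> \<le> L2_norm N f * L2_norm N g"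
proof -
  define A B I where "A = L2_norm N f" and "B = L2_norm N g" and "I = L2_inner N f g"
  have pos: "0 \<le> a\<^sup>2 * A\<^sup>2 + 2 * a * b * I + b\<^sup>2 * B\<^sup>2" for a b
    using L2_norm_lincomb_sq[OF assms, of a b] unfolding A_def B_def I_def by (metis zero_le_power2)
  have "I\<^sup>2 \<le> A\<^sup>2 * B\<^sup>2"
  proof (cases "A\<^sup>2 = 0")
    case False
    then have "0 < A\<^sup>2" by simp
    moreover have "0 \<le> A\<^sup>2 * (A\<^sup>2 * B\<^sup>2 - I\<^sup>2)"
      using pos[of I "-(A\<^sup>2)"] by (simp add: power2_eq_square algebra_simps)
    ultimately show ?thesis by (simp add: zero_le_mult_iff)
  next
    case True
    then have eq: "A = 0" by simp
    have "0 \<le> 2 * a * I + B\<^sup>2" for a using pos[of a 1] eq by simp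
    \<comment> \<open>For nonzero \<open>I\<close> this value of \<open>a\<close> would make the
      right-hand side equal to -1.\<close>
    from this[of "- (B\<^sup>2 + 1) / (2 * I)"] have "I = 0"
      by (cases "I = 0") (auto simp: divide_simps)
    then show ?thesis by simp
  qed
  then have "\<bar>I\<bar>\<^sup>2 \<le> (A * B)\<^sup>2" by (simp add: power_mult_distrib)
  then show ?thesis
    unfolding A_def B_def I_def by (rule power2_le_imp_le) simp
qed

lemma L2_norm_triangle:
  fixes f g :: "'a \<Rightarrow> 'b::euclidean_space"
  assumes "f \<in> L2 N" "g \<in> L2 N"
  shows "L2_norm N (\<lambda>x. f x + g x) \<le> L2_norm N f + L2_norm N g"
proof (rule power2_le_imp_le)
  show "(L2_norm N (\<lambda>x. f x + g x))\<^sup>2 \<le> (L2_norm N f + L2_norm N g)\<^sup>2"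
    using L2_norm_lincomb_sq[OF assms, of 1 1] L2_Cauchy_Schwarz[OF assms]
    by (simp add: power2_sum)
qed simp

lemma L2_norm_triangle_diff:
  fixes f g h :: "'a \<Rightarrow> 'b::euclidean_space"
  assumes "f \<in> L2 N" "g \<in> L2 N" "h \<in> L2 N"
  shows "L2_norm N (\<lambda>x. f x - h x) \<le> L2_norm N (\<lambda>x. f x - g x) + L2_norm N (\<lambda>x. g x - h x)"
  using L2_norm_triangle[OF L2_diff[OF assms(1,2)] L2_diff[OF assms(2,3)]] by simp

section \<open>Completeness of the space of square-integrable functions\<close>

lemma L2_nn_integral:
  assumes "f \<in> L2 N"
  shows "(\<integral>\<^sup>+x. ennreal ((norm (f x))\<^sup>2) \<partial>N) = ennreal ((L2_norm N f)\<^sup>2)"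
  using L2_integrable[OF assms] by (simp add: nn_integral_eq_integral L2_norm_def)

lemma L2_nn_integral_finite:
  assumes "f \<in> borel_measurable N" "(\<integral>\<^sup>+x. ennreal ((norm (f x))\<^sup>2) \<partial>N) < \<infinity>"
  shows "f \<in> L2 N"
  using assms unfolding L2_def by (auto intro!: integrableI_bounded)

text \<open>Riesz-Fischer. Along a subsequence the increments have norm at most
  \<open>(1/4)^k\<close>, so their squares can be weighted by \<open>4^k\<close> and still have a
  summable integral. Almost everywhere the weighted terms are then bounded, the increments decay
  like \<open>(1/2)^k\<close>, and the subsequence converges pointwise. Fatou's lemma turns this
  limit into a norm limit.\<close>

lemma L2_complete:
  fixes X :: "nat \<Rightarrow> 'a \<Rightarrow> 'b::euclidean_space"
  assumes X: "\<And>n. X n \<in> L2 N"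
    and Cauchy: "\<And>e. 0 < e \<Longrightarrow> \<exists>M. \<forall>m\<ge>M. \<forall>n\<ge>M. L2_norm N (\<lambda>x. X m x - X n x) < e"
  shows "\<exists>f\<in>L2 N. (\<lambda>n. L2_norm N (\<lambda>x. X n x - f x)) \<longlonglongrightarrow> 0"
proof -
  have "\<forall>k. \<exists>M. \<forall>m\<ge>M. \<forall>n\<ge>M. L2_norm N (\<lambda>x. X m x - X n x) < (1/4)^k"
    using Cauchy by simp
  then obtain M where M: "\<And>k m n. M k \<le> m \<Longrightarrow> M k \<le> n \<Longrightarrow> L2_norm N (\<lambda>x. X m x - X n x) < (1/4)^k"
    by metis
  \<comment> \<open>This \<open>r\<close> is monotone and dominates \<open>M k\<close>; the summand
    \<open>k\<close> makes it tend to infinity.\<close>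
  define r where "r k = (\<Sum>i\<le>k. M i) + k" for k
  have rM: "M k \<le> r k" for k unfolding r_def by (simp add: member_le_sum trans_le_add1)
  have r_mono: "r k \<le> r (Suc k)" for k by (simp add: r_def)
  have r_ge: "k \<le> r k" for k by (simp add: r_def)
  define \<Delta> where "\<Delta> k x = X (r (Suc k)) x - X (r k) x" for k x
  have \<Delta>_L2: "\<Delta> k \<in> L2 N" for k unfolding \<Delta>_def by (intro L2_diff X)
  have \<Delta>_norm: "L2_norm N (\<Delta> k) \<le> (1/4)^k" for k
    unfolding \<Delta>_def using M[of k "r (Suc k)" "r k"] rM[of k] r_mono[of k] by simp
  have meas [measurable]: "\<Delta> k \<in> borel_measurable N" "X k \<in> borel_measurable N" for k
    using \<Delta>_L2 X by (auto dest: L2_measurable)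
  have "(\<integral>\<^sup>+x. (\<Sum>k. ennreal (4^k * (norm (\<Delta> k x))\<^sup>2)) \<partial>N)
      = (\<Sum>k. \<integral>\<^sup>+x. ennreal (4^k * (norm (\<Delta> k x))\<^sup>2) \<partial>N)"
    by (rule nn_integral_suminf) simp
  also have "\<dots> \<le> (\<Sum>k. ennreal ((1/4)^k))"
  proof (intro suminf_le allI)
    fix k
    have "(\<integral>\<^sup>+x. ennreal (4^k * (norm (\<Delta> k x))\<^sup>2) \<partial>N) = ennreal (4^k) * ennreal ((L2_norm N (\<Delta> k))\<^sup>2)"
      by (simp add: ennreal_mult nn_integral_cmult L2_nn_integral[OF \<Delta>_L2])
    also have "\<dots> = ennreal (4^k * (L2_norm N (\<Delta> k))\<^sup>2)"
      by (simp add: ennreal_mult)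
    also have "4^k * (L2_norm N (\<Delta> k))\<^sup>2 \<le> 4^k * ((1/4)^k)\<^sup>2"
      by (intro mult_left_mono power_mono \<Delta>_norm) auto
    also have "4^k * ((1/4)^k)\<^sup>2 = (1/4::real)^k"
      by (simp add: power2_eq_square power_mult_distrib[symmetric] flip: power_mult_distrib)
    finally show "(\<integral>\<^sup>+x. ennreal (4^k * (norm (\<Delta> k x))\<^sup>2) \<partial>N) \<le> ennreal ((1/4)^k)"
      by (simp add: ennreal_leI)
  qed auto
  also have "\<dots> = ennreal (\<Sum>k. (1/4)^k)"
    by (rule suminf_ennreal2) (auto intro: summable_geometric)
  also have "\<dots> < \<infinity>" by simp
  finally have "AE x in N. (\<Sum>k. ennreal (4^k * (norm (\<Delta> k x))\<^sup>2)) \<noteq> \<infinity>"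
    by (intro nn_integral_PInf_AE) auto
  then have conv: "AE x in N. convergent (\<lambda>k. X (r k) x)"
  proof eventually_elim
    case (elim x)
    then have "summable (\<lambda>k. 4^k * (norm (\<Delta> k x))\<^sup>2)"
      by (intro summable_suminf_not_top) auto
    then have "Bseq (\<lambda>k. 4^k * (norm (\<Delta> k x))\<^sup>2)"
      by (intro convergent_imp_Bseq) (auto dest: summable_LIMSEQ_zero simp: convergent_def)
    then obtain C where C: "0 < C" "\<And>k. 4^k * (norm (\<Delta> k x))\<^sup>2 \<le> C"
      unfolding Bseq_def by auto
    have "norm (\<Delta> k x) \<le> sqrt C * (1/2)^k" for k
    proof -
      have "(2^k * norm (\<Delta> k x))\<^sup>2 \<le> C"
        using C(2)[of k] power_mult_distrib[of "2::real" 2 k]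
        by (simp add: power_mult_distrib power2_eq_square mult_ac)
      then have "2^k * norm (\<Delta> k x) \<le> sqrt C" by (rule real_le_rsqrt)
      then show ?thesis by (simp add: field_simps)
    qed
    moreover have "summable (\<lambda>k. sqrt C * (1/2)^k)"
      by (intro summable_mult summable_geometric) simp
    ultimately have "summable (\<lambda>k. \<Delta> k x)"
      using summable_comparison_test'[of "\<lambda>k. sqrt C * (1/2)^k" 0 "\<lambda>k. \<Delta> k x"] by simp
    then have "convergent (\<lambda>n. \<Sum>k<n. \<Delta> k x)"
      by (simp add: summable_iff_convergent)
    then have "convergent (\<lambda>n. (\<Sum>k<n. \<Delta> k x) + X (r 0) x)"
      by (rule convergent_add[OF _ convergent_const])
    moreover have "(\<Sum>k<n. \<Delta> k x) + X (r 0) x = X (r n) x" for n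
      using sum_lessThan_telescope[of "\<lambda>k. X (r k) x" n] by (simp add: \<Delta>_def)
    ultimately show ?case by simp
  qed
  define f where "f x = lim (\<lambda>k. X (r k) x)" for x
  have f_meas [measurable]: "f \<in> borel_measurable N"
    unfolding f_def by (rule borel_measurable_lim_metric) simp
  \<comment> \<open>Fatou's lemma with \<open>m\<close> fixed and the subsequence index going to
    infinity. The estimate uses the nonnegative integral because \<open>f\<close> is not yet known
    to be square-integrable; that follows from it, as \<open>f\<close> is a member minus a
    difference of finite norm.\<close>
  have bound: "(\<integral>\<^sup>+x. ennreal ((norm (X m x - f x))\<^sup>2) \<partial>N) \<le> ennreal (((1/4)^k)\<^sup>2)" if "M k \<le> m" for m k
  proof -
    have "(\<integral>\<^sup>+x. ennreal ((norm (X m x - f x))\<^sup>2) \<partial>N)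
        = (\<integral>\<^sup>+x. liminf (\<lambda>n. ennreal ((norm (X m x - X (r n) x))\<^sup>2)) \<partial>N)"
      using conv
    proof (intro nn_integral_cong_AE, eventually_elim)
      case (elim x)
      then have "(\<lambda>n. X (r n) x) \<longlonglongrightarrow> f x" by (simp add: f_def convergent_LIMSEQ_iff)
      then have "(\<lambda>n. ennreal ((norm (X m x - X (r n) x))\<^sup>2)) \<longlonglongrightarrow> ennreal ((norm (X m x - f x))\<^sup>2)"
        by (intro tendsto_intros)
      then show ?case by (metis lim_imp_Liminf trivial_limit_sequentially)
    qed
    also have "\<dots> \<le> liminf (\<lambda>n. \<integral>\<^sup>+x. ennreal ((norm (X m x - X (r n) x))\<^sup>2) \<partial>N)"
      by (rule nn_integral_liminf) simp
    also have "\<dots> = liminf (\<lambda>n. ennreal ((L2_norm N (\<lambda>x. X m x - X (r n) x))\<^sup>2))"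
      by (subst L2_nn_integral) (auto intro: L2_diff X)
    also have "\<dots> \<le> ennreal (((1/4)^k)\<^sup>2)"
    proof (rule Liminf_le)
      have "L2_norm N (\<lambda>x. X m x - X (r n) x) \<le> (1/4)^k" if "M k \<le> n" for n
        using M[of k m "r n"] r_ge[of n] that \<open>M k \<le> m\<close> by simp
      then show "\<forall>\<^sub>F n in sequentially.
          ennreal ((L2_norm N (\<lambda>x. X m x - X (r n) x))\<^sup>2) \<le> ennreal (((1/4)^k)\<^sup>2)"
        unfolding eventually_sequentially by (intro exI[of _ "M k"] allI impI ennreal_leI power_mono) auto
    qed simp
    finally show ?thesis .
  qed
  have diff: "(\<lambda>x. X m x - f x) \<in> L2 N" if "M 0 \<le> m" for m
    using bound[OF that] by (intro L2_nn_integral_finite) (auto intro: le_less_trans)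
  have f: "f \<in> L2 N"
    using L2_diff[OF X[of "M 0"] diff[of "M 0"]] by simp
  moreover have "(\<lambda>n. L2_norm N (\<lambda>x. X n x - f x)) \<longlonglongrightarrow> 0"
  proof (rule LIMSEQ_I)
    fix e :: real assume "0 < e"
    then obtain k where k: "(1/4)^k < e" using real_arch_pow_inv[of e "1/4"] by auto
    have "L2_norm N (\<lambda>x. X n x - f x) < e" if "M k \<le> n" for n
    proof -
      have "(L2_norm N (\<lambda>x. X n x - f x))\<^sup>2 \<le> ((1/4)^k)\<^sup>2"
        using bound[OF that] by (simp add: L2_nn_integral L2_diff X f)
      then have "L2_norm N (\<lambda>x. X n x - f x) \<le> (1/4)^k"
        by (rule power2_le_imp_le) simp
      with k show ?thesis by simp
    qed
    then show "\<exists>no. \<forall>n\<ge>no. norm (L2_norm N (\<lambda>x. X n x - f x) - 0) < e"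
      by (intro exI[of _ "M k"]) simp
  qed
  ultimately show ?thesis by blast
qed

section \<open>Firmly nonexpansive maps and proximal maps\<close>

text \<open>A closed subspace, in terms of representatives. Closedness assumes
  \<open>f \<in> L2 N\<close> because convergence of \<open>L2_norm\<close> to 0 alone says nothing
  about a limit that is not square-integrable.\<close>

locale L2_subspace =
  fixes N :: "'a measure" and H :: "('a \<Rightarrow> 'b::euclidean_space) set"
  assumes L2: "f \<in> H \<Longrightarrow> f \<in> L2 N"
    and lincomb: "f \<in> H \<Longrightarrow> g \<in> H \<Longrightarrow> (\<lambda>x. a *\<^sub>R f x + b *\<^sub>R g x) \<in> H"
    and closed: "(\<And>n. X n \<in> H) \<Longrightarrow> f \<in> L2 N \<Longrightarrow>
      (\<lambda>n. L2_norm N (\<lambda>x. X n x - f x)) \<longlonglongrightarrow> 0 \<Longrightarrow> f \<in> H"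
begin

lemma add_mem: "f \<in> H \<Longrightarrow> g \<in> H \<Longrightarrow> (\<lambda>x. f x + g x) \<in> H"
  using lincomb[of f g 1 1] by simp

lemma diff_mem: "f \<in> H \<Longrightarrow> g \<in> H \<Longrightarrow> (\<lambda>x. f x - g x) \<in> H"
  using lincomb[of f g 1 "-1"] by simp

lemma scaleR_mem: "f \<in> H \<Longrightarrow> (\<lambda>x. a *\<^sub>R f x) \<in> H"
  using lincomb[of f f a 0] by simp

lemmas mem = add_mem diff_mem scaleR_mem

definition firmly_nonexpansive :: "(('a \<Rightarrow> 'b) \<Rightarrow> 'a \<Rightarrow> 'b) \<Rightarrow> bool" where
  "firmly_nonexpansive T \<longleftrightarrow> (\<forall>x\<in>H. T x \<in> H) \<and> (\<forall>x\<in>H. \<forall>y\<in>H.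
     (L2_norm N (\<lambda>q. T x q - T y q))\<^sup>2 \<le> L2_inner N (\<lambda>q. x q - y q) (\<lambda>q. T x q - T y q))"

lemma firmly_nonexpansive_mem: "firmly_nonexpansive T \<Longrightarrow> x \<in> H \<Longrightarrow> T x \<in> H"
  by (simp add: firmly_nonexpansive_def)

lemma firmly_nonexpansive_lipschitz:
  assumes "firmly_nonexpansive T" "x \<in> H" "y \<in> H"
  shows "L2_norm N (\<lambda>q. T x q - T y q) \<le> L2_norm N (\<lambda>q. x q - y q)"
proof -
  define d e where "d = L2_norm N (\<lambda>q. T x q - T y q)" and "e = L2_norm N (\<lambda>q. x q - y q)"
  have T: "T x \<in> H" "T y \<in> H" using assms by (auto simp: firmly_nonexpansive_def)
  have "d\<^sup>2 \<le> L2_inner N (\<lambda>q. x q - y q) (\<lambda>q. T x q - T y q)"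
    using assms by (auto simp: firmly_nonexpansive_def d_def)
  also have "\<dots> \<le> e * d"
    unfolding d_def e_def
    by (intro order_trans[OF abs_ge_self L2_Cauchy_Schwarz] L2 mem assms T)
  finally have "d * d \<le> e * d" by (simp add: power2_eq_square)
  moreover have "0 \<le> d" "0 \<le> e" by (simp_all add: d_def e_def)
  ultimately have "d \<le> e" by (cases "d = 0") auto
  then show ?thesis by (simp add: d_def e_def)
qed

text \<open>The expansion of the squared norm of \<open>2d - e\<close> is
  \<open>4|d|^2 - 4<d,e> + |e|^2\<close>, and firm nonexpansiveness says exactly that the first two
  terms add up to at most 0.\<close>

lemma firmly_nonexpansive_reflection:
  assumes "firmly_nonexpansive T" "x \<in> H" "y \<in> H"
  shows "L2_norm N (\<lambda>q. (2 *\<^sub>R T x q - x q) - (2 *\<^sub>R T y q - y q)) \<le> L2_norm N (\<lambda>q. x q - y q)"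
proof (rule power2_le_imp_le)
  define d e where "d = (\<lambda>q. T x q - T y q)" and "e = (\<lambda>q. x q - y q)"
  have T: "T x \<in> H" "T y \<in> H" using assms by (auto simp: firmly_nonexpansive_def)
  have de: "d \<in> L2 N" "e \<in> L2 N" unfolding d_def e_def by (intro L2 mem assms T)+
  have eq: "(\<lambda>q. (2 *\<^sub>R T x q - x q) - (2 *\<^sub>R T y q - y q)) = (\<lambda>q. 2 *\<^sub>R d q + (-1) *\<^sub>R e q)"
    by (simp add: d_def e_def fun_eq_iff algebra_simps)
  have "(L2_norm N d)\<^sup>2 \<le> L2_inner N d e"
    unfolding L2_inner_commute[of N d e] using assms by (auto simp: firmly_nonexpansive_def d_def e_def)
  then show "(L2_norm N (\<lambda>q. (2 *\<^sub>R T x q - x q) - (2 *\<^sub>R T y q - y q)))\<^sup>2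
      \<le> (L2_norm N (\<lambda>q. x q - y q))\<^sup>2"
    unfolding eq L2_norm_lincomb_sq[OF de] by (simp add: e_def[symmetric])
qed simp

text \<open>With \<open>R\<^sub>T = 2T - I\<close>, the step is the convex combination
  \<open>(1 - \<alpha>/2) I + (\<alpha>/2) R\<^sub>Q R\<^sub>P\<close>.\<close>

lemma Douglas_Rachford_nonexpansive:
  fixes P Q :: "('a \<Rightarrow> 'b) \<Rightarrow> 'a \<Rightarrow> 'b" and \<alpha> :: real
  defines "T \<equiv> \<lambda>z q. z q + \<alpha> *\<^sub>R (Q (\<lambda>q'. 2 *\<^sub>R P z q' - z q') q - P z q)"
  assumes P: "firmly_nonexpansive P" and Q: "firmly_nonexpansive Q"
    and \<alpha>: "0 < \<alpha>" "\<alpha> < 2" and xy: "x \<in> H" "y \<in> H"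
  shows "L2_norm N (\<lambda>q. T x q - T y q) \<le> L2_norm N (\<lambda>q. x q - y q)"
proof -
  define u v where "u = (\<lambda>q. 2 *\<^sub>R P x q - x q)" and "v = (\<lambda>q. 2 *\<^sub>R P y q - y q)"
  define r where "r = (\<lambda>q. (2 *\<^sub>R Q u q - u q) - (2 *\<^sub>R Q v q - v q))"
  have Pm: "P x \<in> H" "P y \<in> H" using P xy by (auto simp: firmly_nonexpansive_def)
  have uv: "u \<in> H" "v \<in> H" unfolding u_def v_def by (intro mem xy Pm)+
  have Qm: "Q u \<in> H" "Q v \<in> H" using Q uv by (auto simp: firmly_nonexpansive_def)
  have r: "r \<in> L2 N" unfolding r_def by (intro L2 mem uv Qm)
  have xyL: "(\<lambda>q. x q - y q) \<in> L2 N" by (intro L2 mem xy)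
  have "L2_norm N r \<le> L2_norm N (\<lambda>q. u q - v q)"
    unfolding r_def by (rule firmly_nonexpansive_reflection[OF Q uv])
  also have "\<dots> \<le> L2_norm N (\<lambda>q. x q - y q)"
    unfolding u_def v_def by (rule firmly_nonexpansive_reflection[OF P xy])
  finally have le: "L2_norm N r \<le> L2_norm N (\<lambda>q. x q - y q)" .
  have "T x q - T y q = (1 - \<alpha>/2) *\<^sub>R (x q - y q) + (\<alpha>/2) *\<^sub>R r q" for q
    unfolding T_def r_def u_def[symmetric] v_def[symmetric] by (simp add: u_def v_def algebra_simps)
  then have "L2_norm N (\<lambda>q. T x q - T y q)
      \<le> L2_norm N (\<lambda>q. (1 - \<alpha>/2) *\<^sub>R (x q - y q)) + L2_norm N (\<lambda>q. (\<alpha>/2) *\<^sub>R r q)"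
    by (simp only:) (intro L2_norm_triangle L2_scaleR r xyL)
  also have "\<dots> = (1 - \<alpha>/2) * L2_norm N (\<lambda>q. x q - y q) + (\<alpha>/2) * L2_norm N r"
    using \<alpha> by (simp add: L2_norm_scaleR)
  also have "\<dots> \<le> (1 - \<alpha>/2) * L2_norm N (\<lambda>q. x q - y q) + (\<alpha>/2) * L2_norm N (\<lambda>q. x q - y q)"
    using le \<alpha> by (intro add_left_mono mult_left_mono) auto
  finally show ?thesis by (simp add: algebra_simps)
qed

text \<open>Here \<open>p\<close> and \<open>y\<close> stand for computed values of the projection
  and the proximal map. The exact step from \<open>x\<close> is inserted: nonexpansiveness compares
  it with the exact step from \<open>z\<close>, and only defects separate it from the computed
  step.\<close>

lemma perturbed_Douglas_Rachford_step:
  fixes P Q :: "('a \<Rightarrow> 'b) \<Rightarrow> 'a \<Rightarrow> 'b" and \<alpha> :: real and p y :: "'a \<Rightarrow> 'b"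
  defines "T \<equiv> \<lambda>z q. z q + \<alpha> *\<^sub>R (Q (\<lambda>q'. 2 *\<^sub>R P z q' - z q') q - P z q)"
  assumes P: "firmly_nonexpansive P" and Q: "firmly_nonexpansive Q"
    and \<alpha>: "0 < \<alpha>" "\<alpha> < 2" and H: "z \<in> H" "x \<in> H" "p \<in> H" "y \<in> H"
  shows "L2_norm N (\<lambda>q. T z q - (x q + \<alpha> *\<^sub>R (y q - p q))) \<le> L2_norm N (\<lambda>q. z q - x q) +
    \<alpha> * (3 * L2_norm N (\<lambda>q. p q - P x q) + L2_norm N (\<lambda>q. y q - Q (\<lambda>q. 2 *\<^sub>R p q - x q) q))"
proof -
  define u v where "u = (\<lambda>q. 2 *\<^sub>R P x q - x q)" and "v = (\<lambda>q. 2 *\<^sub>R p q - x q)"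
  have Pm: "P x \<in> H" "P z \<in> H" using P H by (auto simp: firmly_nonexpansive_def)
  have uv: "u \<in> H" "v \<in> H" unfolding u_def v_def by (intro mem H Pm)+
  have Qm: "Q u \<in> H" "Q v \<in> H" "Q (\<lambda>q'. 2 *\<^sub>R P z q' - z q') \<in> H"
    by (intro firmly_nonexpansive_mem[OF Q] uv mem Pm H)+
  have Tm: "T z \<in> H" "T x \<in> H" unfolding T_def u_def[symmetric] by (intro mem H Pm Qm)+
  define w where "w = (\<lambda>q. x q + \<alpha> *\<^sub>R (y q - p q))"
  have w: "w \<in> H" unfolding w_def by (intro mem H)
  \<comment> \<open>\<open>Q v\<close> is the exact map at the computed reflection, which is where
    the defect of the proximal map is taken. What remains, \<open>Q u - Q v\<close>, is controlled
    by \<open>u - v\<close>, a multiple of the projection defect.\<close>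
  have "(\<lambda>q. T x q - w q) =
      (\<lambda>q. \<alpha> *\<^sub>R ((Q u q - Q v q) + ((Q v q - y q) + (p q - P x q))))"
    unfolding T_def w_def u_def[symmetric] by (simp add: fun_eq_iff algebra_simps)
  then have "L2_norm N (\<lambda>q. T x q - w q)
      = \<alpha> * L2_norm N (\<lambda>q. (Q u q - Q v q) + ((Q v q - y q) + (p q - P x q)))"
    using \<alpha> by (simp only: L2_norm_scaleR; simp)
  also have "\<dots> \<le> \<alpha> * (L2_norm N (\<lambda>q. Q u q - Q v q) + L2_norm N (\<lambda>q. (Q v q - y q) + (p q - P x q)))"
    using \<alpha> by (intro mult_left_mono L2_norm_triangle L2 mem Qm H Pm) auto
  also have "\<dots> \<le> \<alpha> * (L2_norm N (\<lambda>q. Q u q - Q v q) +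
      (L2_norm N (\<lambda>q. Q v q - y q) + L2_norm N (\<lambda>q. p q - P x q)))"
    using \<alpha> by (intro mult_left_mono add_left_mono L2_norm_triangle L2 mem Qm H Pm) auto
  also have "L2_norm N (\<lambda>q. Q u q - Q v q) \<le> L2_norm N (\<lambda>q. u q - v q)"
    by (rule firmly_nonexpansive_lipschitz[OF Q uv])
  also have "(\<lambda>q. u q - v q) = (\<lambda>q. (-2) *\<^sub>R (p q - P x q))"
    by (simp add: u_def v_def fun_eq_iff algebra_simps)
  also have "L2_norm N \<dots> = 2 * L2_norm N (\<lambda>q. p q - P x q)"
    by (simp only: L2_norm_scaleR; simp)
  finally have 1: "L2_norm N (\<lambda>q. T x q - w q) \<le>
      \<alpha> * (3 * L2_norm N (\<lambda>q. p q - P x q) + L2_norm N (\<lambda>q. y q - Q v q))"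
    using \<alpha> by (simp add: L2_norm_minus_commute[of N y] algebra_simps)
  have 2: "L2_norm N (\<lambda>q. T z q - T x q) \<le> L2_norm N (\<lambda>q. z q - x q)"
    unfolding T_def by (rule Douglas_Rachford_nonexpansive[OF P Q \<alpha> H(1,2)])
  have "L2_norm N (\<lambda>q. T z q - w q) \<le> L2_norm N (\<lambda>q. T z q - T x q) + L2_norm N (\<lambda>q. T x q - w q)"
    by (intro L2_norm_triangle_diff L2 Tm w)
  with 1 2 show ?thesis unfolding w_def v_def by simp
qed

end

section \<open>Existence and firm nonexpansiveness of proximal maps\<close>

text \<open>Values in \<open>ereal\<close> allow the indicator function of a constraint set, so that
  projection and proximal map are instances of one theory.\<close>

locale L2_convex = L2_subspace N H
  for N :: "'a measure" and H :: "('a \<Rightarrow> 'b::euclidean_space) set" +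
  fixes Y :: "('a \<Rightarrow> 'b) \<Rightarrow> ereal"
  assumes not_MInf: "y \<in> H \<Longrightarrow> Y y \<noteq> -\<infinity>"
    and proper: "\<exists>y\<in>H. Y y \<noteq> \<infinity>"
    and lsc: "y \<in> H \<Longrightarrow> a < Y y \<Longrightarrow>
      \<exists>\<delta>>0. \<forall>z\<in>H. L2_norm N (\<lambda>q. z q - y q) < \<delta> \<longrightarrow> a < Y z"
    and convex: "y \<in> H \<Longrightarrow> z \<in> H \<Longrightarrow> 0 \<le> \<theta> \<Longrightarrow> \<theta> \<le> 1 \<Longrightarrow>
      Y (\<lambda>q. (1 - \<theta>) *\<^sub>R y q + \<theta> *\<^sub>R z q) \<le> ereal (1 - \<theta>) * Y y + ereal \<theta> * Y z"
begin

text \<open>Finite values at both ends force a finite value in between, so later estimates along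
  segments take place in the reals.\<close>

lemma convex_real:
  assumes "y \<in> H" "z \<in> H" "0 \<le> \<theta>" "\<theta> \<le> 1" "Y y = ereal s" "Y z = ereal t"
  obtains r where "Y (\<lambda>q. (1 - \<theta>) *\<^sub>R y q + \<theta> *\<^sub>R z q) = ereal r" "r \<le> (1 - \<theta>) * s + \<theta> * t"
proof -
  have "Y (\<lambda>q. (1 - \<theta>) *\<^sub>R y q + \<theta> *\<^sub>R z q) \<le> ereal ((1 - \<theta>) * s + \<theta> * t)"
    using convex[OF assms(1-4)] assms(5,6) by simp
  moreover have "Y (\<lambda>q. (1 - \<theta>) *\<^sub>R y q + \<theta> *\<^sub>R z q) \<noteq> -\<infinity>"
    by (intro not_MInf lincomb assms)
  ultimately show ?thesis
    using that by (cases "Y (\<lambda>q. (1 - \<theta>) *\<^sub>R y q + \<theta> *\<^sub>R z q)") auto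
qed

text \<open>Lower semicontinuity bounds \<open>Y\<close> from below on a ball around a point of its domain;
  convexity along segments from that point propagates the bound with at most linear decay.\<close>

lemma linear_minorant:
  assumes y0: "y0 \<in> H" and t: "Y y0 = ereal t"
  obtains b where "0 \<le> b" "\<And>y. y \<in> H \<Longrightarrow> ereal (t - 1 - b * L2_norm N (\<lambda>q. y q - y0 q)) \<le> Y y"
proof -
  obtain \<delta> where \<delta>: "0 < \<delta>" "\<And>y. y \<in> H \<Longrightarrow> L2_norm N (\<lambda>q. y q - y0 q) < \<delta> \<Longrightarrow> ereal (t - 1) < Y y"
    using lsc[OF y0, of "ereal (t - 1)"] t by auto
  show ?thesis
  proof (rule that[of "2 / \<delta>"])
    fix y assume y: "y \<in> H"
    define r where "r = L2_norm N (\<lambda>q. y q - y0 q)"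
    have r0: "0 \<le> r" by (simp add: r_def)
    have "ereal (t - 1 - 2 / \<delta> * r) \<le> Y y"
    proof (cases "Y y")
      case (real s)
      show ?thesis
      proof (cases "r < \<delta>")
        case True
        then have "t - 1 < s" using \<delta>(2)[OF y] real by (simp add: r_def)
        moreover have "0 \<le> 2 / \<delta> * r" using \<delta>(1) r0 by simp
        ultimately have "t - 1 - 2 / \<delta> * r \<le> s" by linarith
        then show ?thesis using real by simp
      next
        case False
        \<comment> \<open>This puts \<open>w\<close> at distance \<open>\<delta> / 2\<close> from
          \<open>y0\<close>, inside the ball where \<open>Y\<close> exceeds \<open>t - 1\<close>.
          Convexity then bounds the decrease from \<open>t\<close> to \<open>s\<close> by
          \<open>1 / \<theta> = 2 / \<delta> * r\<close>, the source of the slope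
          \<open>2 / \<delta>\<close>.\<close>
        define \<theta> where "\<theta> = \<delta> / (2 * r)"
        have r: "0 < r" using False \<delta>(1) by simp
        have \<theta>: "0 < \<theta>" "\<theta> \<le> 1" using False \<delta>(1) r by (auto simp: \<theta>_def field_simps)
        define w where "w = (\<lambda>q. (1 - \<theta>) *\<^sub>R y0 q + \<theta> *\<^sub>R y q)"
        have w: "w \<in> H" unfolding w_def by (intro lincomb y y0)
        have "(\<lambda>q. w q - y0 q) = (\<lambda>q. \<theta> *\<^sub>R (y q - y0 q))"
          by (simp add: w_def fun_eq_iff algebra_simps)
        then have "L2_norm N (\<lambda>q. w q - y0 q) = \<theta> * r"
          using \<theta> by (simp only: L2_norm_scaleR r_def; simp)
        also have "\<dots> < \<delta>" using r \<delta>(1) by (simp add: \<theta>_def)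
        finally have "ereal (t - 1) < Y w" by (rule \<delta>(2)[OF w])
        moreover obtain s' where "Y w = ereal s'" "s' \<le> (1 - \<theta>) * t + \<theta> * s"
          unfolding w_def by (rule convex_real[OF y0 y _ _ t real, of \<theta>]) (use \<theta> in auto)
        ultimately have "0 \<le> 1 + \<theta> * (s - t)" by (simp add: algebra_simps)
        also have "\<theta> * (s - t) = \<theta> * (s - t + 2 / \<delta> * r) - 1"
          using r \<delta>(1) by (simp add: \<theta>_def field_simps)
        finally have "0 \<le> s - t + 2 / \<delta> * r" using \<theta>(1) by (simp add: zero_le_mult_iff)
        then show ?thesis using real by simp
      qed
    qed (use not_MInf[OF y] in auto)
    then show "ereal (t - 1 - 2 / \<delta> * L2_norm N (\<lambda>q. y q - y0 q)) \<le> Y y" by (simp add: r_def)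
  qed (use \<delta>(1) in simp)
qed

text \<open>The weight \<open>c\<close> is free: the proximal map takes
  \<open>1 / (2 * \<gamma>)\<close>, the projection takes 1.\<close>

definition objective :: "real \<Rightarrow> ('a \<Rightarrow> 'b) \<Rightarrow> ('a \<Rightarrow> 'b) \<Rightarrow> ereal" where
  "objective c z y = Y y + ereal (c * (L2_norm N (\<lambda>q. y q - z q))\<^sup>2)"

text \<open>The quadratic term outgrows the linear decay of \<open>Y\<close>; completing the square
  gives the constant \<open>b^2 / (4c)\<close>, and \<open>d\<close> accounts for the different
  centres \<open>y0\<close> and \<open>z\<close>.\<close>

lemma objective_bounded_below:
  assumes c: "0 < c" and z: "z \<in> H"
  obtains m where "\<And>y. y \<in> H \<Longrightarrow> ereal m \<le> objective c z y"
proof -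
  obtain y0 t where y0: "y0 \<in> H" "Y y0 = ereal t"
    using proper not_MInf by (metis ereal_cases)
  then obtain b where b: "0 \<le> b"
    "\<And>y. y \<in> H \<Longrightarrow> ereal (t - 1 - b * L2_norm N (\<lambda>q. y q - y0 q)) \<le> Y y"
    using linear_minorant by metis
  define d where "d = L2_norm N (\<lambda>q. z q - y0 q)"
  show ?thesis
  proof (rule that)
    fix y assume y: "y \<in> H"
    define r where "r = L2_norm N (\<lambda>q. y q - z q)"
    have "L2_norm N (\<lambda>q. y q - y0 q) \<le> r + d"
      unfolding r_def d_def by (intro L2_norm_triangle_diff L2 y y0 z)
    then have "b * L2_norm N (\<lambda>q. y q - y0 q) \<le> b * (r + d)" by (rule mult_left_mono) (rule b)
    moreover have "b * r - c * r\<^sup>2 \<le> b\<^sup>2 / (4 * c)"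
    proof -
      have "0 \<le> (2 * c * r - b)\<^sup>2 / (4 * c)" using c by simp
      also have "\<dots> = c * r\<^sup>2 - b * r + b\<^sup>2 / (4 * c)"
        using c by (simp add: field_simps power2_eq_square)
      finally show ?thesis by simp
    qed
    ultimately have "t - 1 - b * d - b\<^sup>2 / (4 * c) \<le> t - 1 - b * L2_norm N (\<lambda>q. y q - y0 q) + c * r\<^sup>2"
      by (simp add: algebra_simps)
    also have "ereal \<dots> \<le> objective c z y"
      unfolding objective_def r_def plus_ereal.simps(1)[symmetric] by (intro add_right_mono b y)
    finally show "ereal (t - 1 - b * d - b\<^sup>2 / (4 * c)) \<le> objective c z y" by simp
  qed
qed

text \<open>The quadratic term makes the objective strongly convex, so a minimizing sequence is
  Cauchy. Strong convergence takes the place of weak compactness, and lower semicontinuity in norm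
  is enough at the limit.\<close>

lemma prox_exists:
  assumes c: "0 < c" and z: "z \<in> H"
  shows "\<exists>p. is_arg_min (objective c z) (\<lambda>y. y \<in> H) p"
proof -
  \<comment> \<open>Only finite values are collected, so the infimum is taken in the reals.\<close>
  define R where "R = {s. \<exists>y\<in>H. objective c z y = ereal s}"
  obtain y0 t where y0: "y0 \<in> H" "Y y0 = ereal t"
    using proper not_MInf by (metis ereal_cases)
  obtain l where l: "\<And>y. y \<in> H \<Longrightarrow> ereal l \<le> objective c z y"
    using objective_bounded_below[OF c z] by blast
  have "objective c z y0 = ereal (t + c * (L2_norm N (\<lambda>q. y0 q - z q))\<^sup>2)"
    using y0(2) by (simp add: objective_def)
  then have "R \<noteq> {}" using y0(1) by (auto simp: R_def)
  have bdd: "bdd_below R" using l by (auto simp: R_def intro!: bdd_belowI[of _ l] dest!: l)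
  define m where "m = Inf R"
  have m_le: "ereal m \<le> objective c z y" if "y \<in> H" for y
  proof (cases "objective c z y")
    case (real s)
    then have "s \<in> R" using that by (auto simp: R_def)
    then have "m \<le> s" unfolding m_def by (rule cInf_lower) (rule bdd)
    then show ?thesis using real by simp
  qed (use l[OF that] in auto)
  have "\<exists>y\<in>H. \<exists>s. objective c z y = ereal s \<and> s < m + 1 / real (Suc n)" for n
  proof -
    have "Inf R < m + 1 / real (Suc n)" by (simp add: m_def)
    then obtain s where "s \<in> R" "s < m + 1 / real (Suc n)"
      using cInf_lessD[OF \<open>R \<noteq> {}\<close>] by blast
    then show ?thesis by (auto simp: R_def)
  qed
  then obtain y s where y: "\<And>n. y n \<in> H" and s: "\<And>n. objective c z (y n) = ereal (s n)"
    and s_less: "\<And>n. s n < m + 1 / real (Suc n)" by metis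
  define A where "A n = L2_norm N (\<lambda>q. y n q - z q)" for n
  have Yy: "Y (y n) = ereal (s n - c * (A n)\<^sup>2)" for n
    using s[of n] by (cases "Y (y n)") (auto simp: objective_def A_def)
  \<comment> \<open>The midpoint \<open>w\<close> has objective at least \<open>m\<close>, while
    both endpoints exceed \<open>m\<close> by little. By the parallelogram identity the distance
    term at \<open>w\<close> falls below the average by a quarter of the squared distance of the
    endpoints, which must therefore be small.\<close>
  have Cauchy: "c * (L2_norm N (\<lambda>q. y i q - y j q))\<^sup>2 \<le> 2 / real (Suc i) + 2 / real (Suc j)" for i j
  proof -
    define w where "w = (\<lambda>q. (1 - 1/2) *\<^sub>R y i q + (1/2) *\<^sub>R y j q)"
    have w: "w \<in> H" unfolding w_def by (intro lincomb y)
    obtain r where r: "Y w = ereal r"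
      "r \<le> (1 - 1/2) * (s i - c * (A i)\<^sup>2) + (1/2) * (s j - c * (A j)\<^sup>2)"
      unfolding w_def by (rule convex_real[OF y y _ _ Yy Yy, of "1/2"]) auto
    have mems: "(\<lambda>q. y i q - z q) \<in> L2 N" "(\<lambda>q. y j q - z q) \<in> L2 N"
      by (intro L2 mem y z)+
    have "(\<lambda>q. w q - z q) = (\<lambda>q. (1/2) *\<^sub>R (y i q - z q) + (1/2) *\<^sub>R (y j q - z q))"
      by (simp add: w_def fun_eq_iff algebra_simps flip: scaleR_add_left)
    moreover have "(\<lambda>q. y i q - y j q) = (\<lambda>q. 1 *\<^sub>R (y i q - z q) + (-1) *\<^sub>R (y j q - z q))"
      by simp
    ultimately have "(L2_norm N (\<lambda>q. w q - z q))\<^sup>2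
        = (A i)\<^sup>2 / 2 + (A j)\<^sup>2 / 2 - (L2_norm N (\<lambda>q. y i q - y j q))\<^sup>2 / 4"
      by (simp only: L2_norm_lincomb_sq[OF mems]) (simp add: A_def power2_eq_square field_simps)
    moreover have "m \<le> r + c * (L2_norm N (\<lambda>q. w q - z q))\<^sup>2"
      using m_le[OF w] r(1) by (simp add: objective_def)
    ultimately have "m \<le> r + c * ((A i)\<^sup>2 / 2 + (A j)\<^sup>2 / 2 - (L2_norm N (\<lambda>q. y i q - y j q))\<^sup>2 / 4)"
      by simp
    then have "c * (L2_norm N (\<lambda>q. y i q - y j q))\<^sup>2 / 4 \<le> s i / 2 + s j / 2 - m"
      using r(2) by (simp add: algebra_simps)
    then show ?thesis using s_less[of i] s_less[of j] by simp
  qed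
  have "\<exists>p\<in>L2 N. (\<lambda>n. L2_norm N (\<lambda>q. y n q - p q)) \<longlonglongrightarrow> 0"
  proof (rule L2_complete)
    show "y n \<in> L2 N" for n by (intro L2 y)
    fix e :: real assume e: "0 < e"
    obtain M :: nat where M: "4 / (c * e\<^sup>2) < real M" using reals_Archimedean2 by blast
    have "L2_norm N (\<lambda>q. y i q - y j q) < e" if "M \<le> i" "M \<le> j" for i j
    proof (rule power2_less_imp_less)
      have pos: "0 < 4 / (c * e\<^sup>2)" using c e by simp
      then have M0: "0 < real M" using M by linarith
      have le: "2 / real (Suc k) \<le> 2 / real M" if "M \<le> k" for k
        using that M0 by (intro divide_left_mono) auto
      have "c * (L2_norm N (\<lambda>q. y i q - y j q))\<^sup>2 \<le> 2 / real M + 2 / real M"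
        using Cauchy[of i j] le[OF that(1)] le[OF that(2)] by linarith
      then have "c * (L2_norm N (\<lambda>q. y i q - y j q))\<^sup>2 \<le> 4 / real M" by simp
      also have "\<dots> < c * e\<^sup>2" using M M0 c e by (simp add: field_simps)
      finally show "(L2_norm N (\<lambda>q. y i q - y j q))\<^sup>2 < e\<^sup>2" using c by simp
    qed (use e in simp)
    then show "\<exists>M. \<forall>i\<ge>M. \<forall>j\<ge>M. L2_norm N (\<lambda>q. y i q - y j q) < e" by blast
  qed
  then obtain p where pL: "p \<in> L2 N" and lim: "(\<lambda>n. L2_norm N (\<lambda>q. y n q - p q)) \<longlonglongrightarrow> 0" by blast
  have p: "p \<in> H" using closed[OF y pL lim] .
  define B where "B = L2_norm N (\<lambda>q. p q - z q)"
  have "(\<lambda>n. A n - B) \<longlonglongrightarrow> 0"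
  proof (rule Lim_null_comparison[OF _ lim], intro always_eventually allI)
    fix n
    have "A n \<le> L2_norm N (\<lambda>q. y n q - p q) + B" "B \<le> L2_norm N (\<lambda>q. p q - y n q) + A n"
      unfolding A_def B_def by (intro L2_norm_triangle_diff L2 y p z)+
    then show "norm (A n - B) \<le> L2_norm N (\<lambda>q. y n q - p q)"
      by (simp add: L2_norm_minus_commute[of N p])
  qed
  then have A_lim: "A \<longlonglongrightarrow> B" by (rule LIM_zero_cancel)
  have "objective c z p \<le> ereal m"
  proof -
    have "ereal (s n - c * (A n)\<^sup>2) \<le> ereal (m + 1 / real (Suc n) - c * (A n)\<^sup>2)" for n
      using s_less[of n] by simp
    have lim2: "(\<lambda>n. m + 1 / real (Suc n) - c * (A n)\<^sup>2) \<longlonglongrightarrow> m + 0 - c * B\<^sup>2"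
      by (intro tendsto_intros A_lim LIMSEQ_Suc[OF lim_1_over_n])
    \<comment> \<open>Every real below \<open>Y p\<close> is eventually below
      \<open>Y (y n)\<close>, which is less than a sequence converging to
      \<open>m - c * B^2\<close>. Arguing with reals \<open>a\<close> also excludes the value
      \<infinity> for \<open>Y p\<close>.\<close>
    have a_le: "a \<le> m - c * B\<^sup>2" if a: "ereal a < Y p" for a
    proof -
      obtain \<delta> where \<delta>: "0 < \<delta>" "\<And>w. w \<in> H \<Longrightarrow> L2_norm N (\<lambda>q. w q - p q) < \<delta> \<Longrightarrow> ereal a < Y w"
        using lsc[OF p a] by blast
      have "\<forall>\<^sub>F n in sequentially. L2_norm N (\<lambda>q. y n q - p q) < \<delta>"
        using order_tendstoD(2)[OF lim \<delta>(1)] .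
      then have "\<forall>\<^sub>F n in sequentially. a \<le> m + 1 / real (Suc n) - c * (A n)\<^sup>2"
      proof eventually_elim
        case (elim n)
        then show ?case using \<delta>(2)[OF y elim] Yy[of n] s_less[of n] by simp
      qed
      then show ?thesis using tendsto_lowerbound[OF lim2] by simp
    qed
    have "Y p \<le> ereal (m - c * B\<^sup>2)"
    proof (rule ccontr)
      assume "\<not> Y p \<le> ereal (m - c * B\<^sup>2)"
      then obtain a where "ereal (m - c * B\<^sup>2) < ereal a" "ereal a < Y p"
        using ereal_dense2 by (meson not_le)
      then show False using a_le[of a] by simp
    qed
    then show ?thesis by (cases "Y p") (auto simp: objective_def B_def)
  qed
  then have "objective c z p \<le> objective c z w" if "w \<in> H" for w using m_le[OF that] by simp
  then show ?thesis using p by (auto simp: is_arg_min_linorder)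
qed

lemma prox_finite:
  assumes "is_arg_min (objective c z) (\<lambda>y. y \<in> H) p"
  obtains s where "Y p = ereal s"
proof -
  obtain y0 t where y0: "y0 \<in> H" "Y y0 = ereal t"
    using proper not_MInf by (metis ereal_cases)
  have "p \<in> H" "objective c z p \<le> objective c z y0"
    using assms y0 by (auto simp: is_arg_min_linorder)
  then show ?thesis
    using that y0 not_MInf[of p] by (cases "Y p") (auto simp: objective_def)
qed

text \<open>First-order optimality: \<open>p\<close> is compared with points on the segment towards
  \<open>y\<close>, the inequality is divided by \<open>\<theta>\<close>, and the quadratic
  remainder vanishes as \<open>\<theta>\<close> tends to 0 from the right.\<close>

lemma prox_variational_inequality:
  assumes c: "0 < c" and z: "z \<in> H" and p: "is_arg_min (objective c z) (\<lambda>y. y \<in> H) p"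
    and y: "y \<in> H" and s: "Y p = ereal s" and t: "Y y = ereal t"
  shows "s \<le> t + 2 * c * L2_inner N (\<lambda>q. p q - z q) (\<lambda>q. y q - p q)"
proof -
  have pH: "p \<in> H" using p by (simp add: is_arg_min_linorder)
  define f g where "f = (\<lambda>q. p q - z q)" and "g = (\<lambda>q. y q - p q)"
  have fg: "f \<in> L2 N" "g \<in> L2 N" unfolding f_def g_def by (intro L2 mem pH y z)+
  define I B where "I = L2_inner N f g" and "B = (L2_norm N g)\<^sup>2"
  have ineq: "s - t \<le> 2 * c * I + \<theta> * (c * B)" if \<theta>: "0 < \<theta>" "\<theta> \<le> 1" for \<theta>
  proof -
    define w where "w = (\<lambda>q. (1 - \<theta>) *\<^sub>R p q + \<theta> *\<^sub>R y q)"
    have w: "w \<in> H" unfolding w_def by (intro lincomb pH y)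
    obtain r where r: "Y w = ereal r" "r \<le> (1 - \<theta>) * s + \<theta> * t"
      unfolding w_def by (rule convex_real[OF pH y _ _ s t, of \<theta>]) (use \<theta> in auto)
    have "(\<lambda>q. w q - z q) = (\<lambda>q. 1 *\<^sub>R f q + \<theta> *\<^sub>R g q)"
      by (simp add: w_def f_def g_def fun_eq_iff algebra_simps)
    then have eq: "(L2_norm N (\<lambda>q. w q - z q))\<^sup>2 = (L2_norm N f)\<^sup>2 + 2 * \<theta> * I + \<theta>\<^sup>2 * B"
      by (simp only: L2_norm_lincomb_sq[OF fg]) (simp add: I_def B_def)
    have "objective c z p \<le> objective c z w" using p w by (simp add: is_arg_min_linorder)
    then have "s + c * (L2_norm N f)\<^sup>2 \<le> r + c * ((L2_norm N f)\<^sup>2 + 2 * \<theta> * I + \<theta>\<^sup>2 * B)"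
      using s r(1) by (simp add: objective_def f_def[symmetric] eq)
    then have "\<theta> * (s - t) \<le> \<theta> * (2 * c * I + \<theta> * (c * B))"
      using r(2) by (simp add: algebra_simps power2_eq_square)
    then show ?thesis using \<theta>(1) by simp
  qed
  have "((\<lambda>\<theta>. 2 * c * I + \<theta> * (c * B)) \<longlongrightarrow> 2 * c * I + 0 * (c * B)) (at_right 0)"
    by (intro tendsto_intros)
  moreover have "\<forall>\<^sub>F \<theta> in at_right 0. s - t \<le> 2 * c * I + \<theta> * (c * B)"
    unfolding eventually_at_right_field using ineq by (intro exI[of _ 1]) auto
  ultimately have "s - t \<le> 2 * c * I"
    using tendsto_lowerbound by fastforce
  then show ?thesis by (simp add: I_def f_def g_def)
qed

text \<open>The variational inequality at each of \<open>T x\<close>, \<open>T y\<close> is tested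
  with the other point. On adding them the finite values of \<open>Y\<close> cancel, and
  \<open>c\<close> divides out.\<close>

lemma prox_firmly_nonexpansive:
  assumes c: "0 < c" and T: "\<And>z. z \<in> H \<Longrightarrow> is_arg_min (objective c z) (\<lambda>y. y \<in> H) (T z)"
  shows "firmly_nonexpansive T"
  unfolding firmly_nonexpansive_def
proof (intro conjI ballI)
  show mems: "T x \<in> H" if "x \<in> H" for x using T[OF that] by (simp add: is_arg_min_linorder)
  fix x y assume xy: "x \<in> H" "y \<in> H"
  note Txy = mems[OF xy(1)] mems[OF xy(2)]
  define d where "d = (\<lambda>q. T x q - T y q)"
  have d: "d \<in> L2 N" unfolding d_def by (intro L2 mem Txy)
  obtain s t where st: "Y (T x) = ereal s" "Y (T y) = ereal t"
    using prox_finite[OF T[OF xy(1)]] prox_finite[OF T[OF xy(2)]] by metis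
  have mL: "x \<in> L2 N" "y \<in> L2 N" "T x \<in> L2 N" "T y \<in> L2 N" by (intro L2 xy Txy)+
  have neg: "L2_inner N f (\<lambda>q. T y q - T x q) = - L2_inner N f d" for f
    unfolding d_def L2_inner_def by (simp add: inner_diff_right flip: Bochner_Integration.integral_minus)
  have "s \<le> t - 2 * c * L2_inner N (\<lambda>q. T x q - x q) d"
    using prox_variational_inequality[OF c xy(1) T[OF xy(1)] Txy(2) st] by (simp add: neg)
  moreover have "t \<le> s + 2 * c * L2_inner N (\<lambda>q. T y q - y q) d"
    using prox_variational_inequality[OF c xy(2) T[OF xy(2)] Txy(1) st(2,1)] by (simp add: d_def)
  ultimately have "0 \<le> c * (L2_inner N (\<lambda>q. T y q - y q) d - L2_inner N (\<lambda>q. T x q - x q) d)"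
    by (simp add: algebra_simps)
  then have "0 \<le> L2_inner N (\<lambda>q. T y q - y q) d - L2_inner N (\<lambda>q. T x q - x q) d"
    using c by (simp add: zero_le_mult_iff)
  also have "\<dots> = L2_inner N (\<lambda>q. x q - y q) d - L2_inner N d d"
    by (subst (4) d_def) (simp add: L2_inner_diff_left mL d)
  finally show "(L2_norm N (\<lambda>q. T x q - T y q))\<^sup>2 \<le> L2_inner N (\<lambda>q. x q - y q) (\<lambda>q. T x q - T y q)"
    by (simp add: L2_norm_sq flip: d_def)
qed

end

section \<open>Projection and proximal map in the Hilbert space\<close>

lemma L2_Pair:
  fixes f :: "'a \<Rightarrow> 'b::euclidean_space" and g :: "'a \<Rightarrow> 'c::euclidean_space"
  assumes "f \<in> L2 N" "g \<in> L2 N"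
  shows "(\<lambda>x. (f x, g x)) \<in> L2 N"
  using assms by (auto simp: L2_def norm_Pair)

lemma L2_components:
  fixes z :: "'a \<Rightarrow> 'b::euclidean_space \<times> 'c::euclidean_space"
  assumes "z \<in> L2 N"
  shows "fst \<circ> z \<in> L2 N" "snd \<circ> z \<in> L2 N"
proof -
  have z: "z \<in> borel_measurable N" using assms by (simp add: L2_def)
  have "fst \<circ> z \<in> borel_measurable N" "snd \<circ> z \<in> borel_measurable N"
    unfolding comp_def by (intro measurable_compose[OF z] borel_measurable_continuous_onI continuous_intros)+
  moreover have "(norm (fst (z x)))\<^sup>2 \<le> (norm (z x))\<^sup>2" "(norm (snd (z x)))\<^sup>2 \<le> (norm (z x))\<^sup>2" for x
    by (simp_all add: norm_prod_def)
  ultimately show "fst \<circ> z \<in> L2 N" "snd \<circ> z \<in> L2 N"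
    by (auto intro!: L2I_le[OF _ L2_integrable[OF assms]])
qed

lemma L2_inner_Pair:
  fixes z :: "'a \<Rightarrow> 'b::euclidean_space \<times> 'c::euclidean_space"
  assumes "z \<in> L2 N" "d \<in> L2 N" "g \<in> L2 N"
  shows "L2_inner N (fst \<circ> z) d + L2_inner N (snd \<circ> z) g = L2_inner N z (\<lambda>x. (d x, g x))"
  using L2_inner_integrable[OF L2_components(1)[OF assms(1)] assms(2)]
    L2_inner_integrable[OF L2_components(2)[OF assms(1)] assms(3)]
  by (simp add: L2_inner_def inner_prod_def)

text \<open>Pairs of square-integrable components are identified with one square-integrable
  pair-valued function, leaving tangency as a linear side condition.\<close>

lemma HH_eq: "HH S = {z \<in> L2 (cyl S). tangential S (snd \<circ> z)}"
  using L2_Pair[of "fst \<circ> z" "cyl S" "snd \<circ> z" for z]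
  by (fastforce simp: HH_def intro: L2_components)

text \<open>Membership matters: if one component is not square-integrable, its norm defaults to 0 on
  the left while the whole norm defaults to 0 on the right.\<close>

lemma normH_eq:
  assumes "z \<in> L2 (cyl S)"
  shows "normH S z = L2_norm (cyl S) z"
proof -
  have "(normH S z)\<^sup>2 = L2_inner (cyl S) (fst \<circ> z) (fst \<circ> z) + L2_inner (cyl S) (snd \<circ> z) (snd \<circ> z)"
    by (simp add: normH_def L2_norm_sq[symmetric])
  also have "\<dots> = (L2_norm (cyl S) z)\<^sup>2"
    using L2_inner_Pair[OF assms L2_components[OF assms]] by (simp add: L2_norm_sq)
  finally show ?thesis by (rule power2_eq_imp_eq) (auto simp: normH_def)
qed

lemma space_S_area: "closed_surface S \<Longrightarrow> space (S_area S) = S_set S"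
  using sets_eq_imp_space_eq[of "S_area S" "restrict_space borel (S_set S)"]
  by (simp add: closed_surface_def space_restrict_space)

lemma norm_S_nu: "closed_surface S \<Longrightarrow> x \<in> S_set S \<Longrightarrow> norm (S_nu S x) = 1"
  by (simp add: closed_surface_def)

lemma S_nu_measurable:
  assumes "closed_surface S"
  shows "S_nu S \<in> borel_measurable (S_area S)"
proof -
  have "sets (S_area S) = sets (restrict_space borel (S_set S))" "continuous_on (S_set S) (S_nu S)"
    using assms by (auto simp: closed_surface_def)
  then show ?thesis
    using borel_measurable_continuous_on_restrict measurable_cong_sets by blast
qed

lemma snd_cyl_measurable: "snd \<in> cyl S \<rightarrow>\<^sub>M S_area S"
  by (simp add: cyl_def)

lemma fst_cyl_measurable: "fst \<in> borel_measurable (cyl S)"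
proof -
  have "fst \<in> cyl S \<rightarrow>\<^sub>M restrict_space lborel {0<..<1}" by (simp add: cyl_def)
  moreover have "(\<lambda>t::real. t) \<in> borel_measurable (restrict_space lborel {0<..<1})"
    by (intro measurable_restrict_space1) simp
  ultimately show ?thesis using measurable_comp[of fst "cyl S"] by (simp add: comp_def)
qed

lemma space_cyl: "closed_surface S \<Longrightarrow> space (cyl S) = {0<..<1} \<times> S_set S"
  by (simp add: cyl_def space_pair_measure space_restrict_space space_S_area)

text \<open>For closedness, the normal component \<open>h\<close> of the limit is pointwise at most
  \<open>norm (X n q - f q)\<close> almost everywhere, since \<open>X n\<close> has no normal
  component and the normal has length 1. Its square integral is thus below every term of a null
  sequence.\<close>

lemma HH_subspace:
  assumes S: "closed_surface S"
  shows "L2_subspace (cyl S) (HH S)"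
proof
  show "f \<in> HH S \<Longrightarrow> f \<in> L2 (cyl S)" for f by (simp add: HH_eq)
  show "(\<lambda>x. a *\<^sub>R f x + b *\<^sub>R g x) \<in> HH S" if "f \<in> HH S" "g \<in> HH S" for f g a b
  proof -
    have "AE q in cyl S. snd (f q) \<bullet> S_nu S (snd q) = 0" "AE q in cyl S. snd (g q) \<bullet> S_nu S (snd q) = 0"
      using that by (auto simp: HH_eq tangential_def)
    then have "AE q in cyl S. snd (a *\<^sub>R f q + b *\<^sub>R g q) \<bullet> S_nu S (snd q) = 0"
      by eventually_elim (simp add: inner_add_left)
    then show ?thesis using that by (auto simp: HH_eq tangential_def intro: L2_lincomb)
  qed
  fix X and f :: state
  assume X: "\<And>n::nat. X n \<in> HH S" and f: "f \<in> L2 (cyl S)"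
    and lim: "(\<lambda>n. L2_norm (cyl S) (\<lambda>x. X n x - f x)) \<longlonglongrightarrow> 0"
  define h where "h q = snd (f q) \<bullet> S_nu S (snd q)" for q
  have [measurable]: "(\<lambda>q. snd (f q)) \<in> borel_measurable (cyl S)"
    using L2_components(2)[OF f] by (simp add: L2_def comp_def)
  have [measurable]: "(\<lambda>q. S_nu S (snd q)) \<in> borel_measurable (cyl S)"
    by (rule measurable_compose[OF snd_cyl_measurable S_nu_measurable[OF S]])
  have h_meas [measurable]: "h \<in> borel_measurable (cyl S)"
    unfolding h_def by (intro borel_measurable_inner) measurable
  have XL: "X n \<in> L2 (cyl S)" for n using X by (simp add: HH_eq)
  have le: "(\<integral>\<^sup>+q. ennreal ((h q)\<^sup>2) \<partial>cyl S) \<le> ennreal ((L2_norm (cyl S) (\<lambda>q. X n q - f q))\<^sup>2)" for n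
  proof -
    have "AE q in cyl S. snd (X n q) \<bullet> S_nu S (snd q) = 0"
      using X[of n] by (simp add: HH_eq tangential_def)
    then have "AE q in cyl S. (h q)\<^sup>2 \<le> (norm (X n q - f q))\<^sup>2"
      using AE_space
    proof eventually_elim
      case (elim q)
      have "\<bar>h q\<bar> = \<bar>snd (X n q - f q) \<bullet> S_nu S (snd q)\<bar>"
        using elim(1) by (simp add: h_def inner_diff_left)
      also have "\<dots> \<le> norm (snd (X n q - f q))"
        using Cauchy_Schwarz_ineq2[of "snd (X n q - f q)" "S_nu S (snd q)"]
          norm_S_nu[OF S, of "snd q"] elim(2) by (auto simp: space_cyl[OF S])
      also have "\<dots> \<le> norm (X n q - f q)" by (metis norm_snd_le prod.collapse)
      finally show ?case using power_mono[of "\<bar>h q\<bar>" _ 2] by simp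
    qed
    then have "(\<integral>\<^sup>+q. ennreal ((h q)\<^sup>2) \<partial>cyl S) \<le> (\<integral>\<^sup>+q. ennreal ((norm (X n q - f q))\<^sup>2) \<partial>cyl S)"
      by (intro nn_integral_mono_AE) (auto elim!: eventually_mono intro: ennreal_leI)
    then show ?thesis by (simp add: L2_nn_integral L2_diff XL f)
  qed
  have "(\<lambda>n. ennreal ((L2_norm (cyl S) (\<lambda>q. X n q - f q))\<^sup>2)) \<longlonglongrightarrow> ennreal (0\<^sup>2)"
    by (intro tendsto_intros lim)
  then have "(\<integral>\<^sup>+q. ennreal ((h q)\<^sup>2) \<partial>cyl S) \<le> 0"
    using LIMSEQ_le_const[of _ "ennreal (0\<^sup>2)"] le by fastforce
  then have "AE q in cyl S. ennreal ((h q)\<^sup>2) = 0"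
    by (simp add: nn_integral_0_iff_AE)
  then have "AE q in cyl S. h q = 0" by simp
  then show "f \<in> HH S" using f by (simp add: HH_eq tangential_def h_def)
qed

lemma L2_convexI:
  assumes S: "closed_surface S" and Y: "properH S Y" "lscH S Y" "convexH S Y"
  shows "L2_convex (cyl S) (HH S) Y"
proof -
  interpret L2_subspace "cyl S" "HH S" by (rule HH_subspace[OF S])
  show ?thesis
  proof
    show "\<exists>\<delta>>0. \<forall>z\<in>HH S. L2_norm (cyl S) (\<lambda>q. z q - y q) < \<delta> \<longrightarrow> a < Y z"
      if "y \<in> HH S" "a < Y y" for y a
    proof -
      obtain \<delta> where "0 < \<delta>" "\<And>z. z \<in> HH S \<Longrightarrow> normH S (\<lambda>q. z q - y q) < \<delta> \<Longrightarrow> a < Y z"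
        using Y(2)[unfolded lscH_def, rule_format, OF \<open>y \<in> HH S\<close> \<open>a < Y y\<close>] by blast
      moreover have "normH S (\<lambda>q. z q - y q) = L2_norm (cyl S) (\<lambda>q. z q - y q)" if "z \<in> HH S" for z
        using that \<open>y \<in> HH S\<close> by (intro normH_eq L2 diff_mem)
      ultimately show ?thesis by (intro exI[of _ \<delta>]) simp
    qed
    show "Y y \<noteq> -\<infinity>" if "y \<in> HH S" for y using Y(1) that by (simp add: properH_def)
    show "\<exists>y\<in>HH S. Y y \<noteq> \<infinity>" using Y(1) by (simp add: properH_def)
  qed (use Y(3) in \<open>simp add: convexH_def\<close>)
qed

lemma arg_min_cong:
  assumes "\<And>x. P x \<Longrightarrow> f x = g x"
  shows "arg_min f P = arg_min g P"
proof -
  have "is_arg_min f P = is_arg_min g P" using assms by (fastforce simp: is_arg_min_def)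
  then show ?thesis by (simp add: arg_min_def)
qed

text \<open>\<open>normH\<close> and \<open>L2_norm\<close> agree only for differences of members,
  which suffices because the minimization runs over \<open>HH S\<close>.\<close>

lemma prox_is_arg_min:
  assumes S: "closed_surface S" and Y: "L2_convex (cyl S) (HH S) Y"
    and \<gamma>: "0 < \<gamma>" and z: "z \<in> HH S"
  shows "is_arg_min (L2_convex.objective (cyl S) Y (1 / (2 * \<gamma>)) z) (\<lambda>y. y \<in> HH S) (prox S \<gamma> Y z)"
proof -
  interpret L2_convex "cyl S" "HH S" Y by (rule Y)
  have "normH S (\<lambda>q. y q - z q) = L2_norm (cyl S) (\<lambda>q. y q - z q)" if "y \<in> HH S" for y
    by (intro normH_eq L2 diff_mem that z)
  then have "prox S \<gamma> Y z = arg_min (objective (1 / (2 * \<gamma>)) z) (\<lambda>y. y \<in> HH S)"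
    unfolding prox_def by (intro arg_min_cong) (simp add: objective_def)
  moreover have "\<exists>p. is_arg_min (objective (1 / (2 * \<gamma>)) z) (\<lambda>y. y \<in> HH S) p"
    using \<gamma> z by (intro prox_exists) auto
  ultimately show ?thesis by (simp add: arg_min_def someI_ex)
qed

lemma prox_firmly_nonexpansive_HH:
  assumes S: "closed_surface S" and Y: "L2_convex (cyl S) (HH S) Y" and \<gamma>: "0 < \<gamma>"
  shows "L2_subspace.firmly_nonexpansive (cyl S) (HH S) (prox S \<gamma> Y)"
proof -
  interpret L2_convex "cyl S" "HH S" Y by (rule Y)
  show ?thesis
    using \<gamma> by (intro prox_firmly_nonexpansive[of "1 / (2 * \<gamma>)"] prox_is_arg_min S Y) auto
qed

section \<open>The continuity constraint and its projection\<close>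

lemma CC_subset: "CC S \<rho>0 \<rho>1 \<subseteq> HH S"
  by (auto simp: CC_def)

text \<open>The projection onto a set is the proximal map of its indicator function, up to squaring
  the distance.\<close>

lemma CC_indicator_convex:
  assumes S: "closed_surface S" and ne: "CC S \<rho>0 \<rho>1 \<noteq> {}"
  shows "L2_convex (cyl S) (HH S) (\<lambda>y. if y \<in> CC S \<rho>0 \<rho>1 then 0 else \<infinity>)"
proof -
  interpret L2_subspace "cyl S" "HH S" by (rule HH_subspace[OF S])
  define C where "C = CC S \<rho>0 \<rho>1"
  \<comment> \<open>Each test function contributes one prescribed inner product with a fixed element
    of \<open>L2\<close>, so the constraint set is an intersection of closed hyperplanes.\<close>
  have C_iff: "z \<in> C \<longleftrightarrow> z \<in> HH S \<and> (\<forall>\<psi> d g \<psi>0 \<psi>1. H1 S \<psi> d g \<psi>0 \<psi>1 \<longrightarrow>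
      L2_inner (cyl S) z (\<lambda>q. (d q, g q)) = L2_inner (S_area S) \<rho>1 \<psi>1 - L2_inner (S_area S) \<rho>0 \<psi>0)" for z
  proof (cases "z \<in> HH S")
    case True
    then have "z \<in> L2 (cyl S)" by (rule L2)
    then show ?thesis
      unfolding C_def CC_def by (auto simp: H1_def L2_inner_Pair)
  qed (simp add: C_def CC_def)
  have "L2_convex (cyl S) (HH S) (\<lambda>y. if y \<in> C then 0 else \<infinity>)"
  proof
    show "\<exists>y\<in>HH S. (if y \<in> C then 0 else \<infinity>) \<noteq> (\<infinity>::ereal)"
      using ne CC_subset unfolding C_def by fastforce
    show "\<exists>\<delta>>0. \<forall>z\<in>HH S. L2_norm (cyl S) (\<lambda>q. z q - y q) < \<delta> \<longrightarrow> a < (if z \<in> C then 0 else \<infinity>)"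
      if y: "y \<in> HH S" and a: "a < (if y \<in> C then 0 else \<infinity>)" for y and a :: ereal
    proof (cases "y \<in> C")
      case True
      then have "a < 0" using a by simp
      moreover have "(0::ereal) < \<infinity>" by simp
      ultimately have "a < (if z \<in> C then 0 else \<infinity>)" for z by (auto intro: less_trans)
      then show ?thesis by (intro exI[of _ 1]) simp
    next
      case False
      then obtain \<psi> d g \<psi>0 \<psi>1 where H1: "H1 S \<psi> d g \<psi>0 \<psi>1"
        and neq: "L2_inner (cyl S) y (\<lambda>q. (d q, g q)) \<noteq>
          L2_inner (S_area S) \<rho>1 \<psi>1 - L2_inner (S_area S) \<rho>0 \<psi>0"
        using C_iff y by blast
      define w where "w = (\<lambda>q. (d q, g q))"
      define k where "k = L2_inner (S_area S) \<rho>1 \<psi>1 - L2_inner (S_area S) \<rho>0 \<psi>0"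
      \<comment> \<open>Moving \<open>y\<close> by less than \<open>\<delta>\<close> changes the
        inner product with \<open>w\<close> by less than the violation of the constraint, so the
        complement of \<open>C\<close> is open. The added 1 covers the case that \<open>w\<close>
        has norm 0.\<close>
      define \<delta> where "\<delta> = \<bar>L2_inner (cyl S) y w - k\<bar> / (L2_norm (cyl S) w + 1)"
      have w: "w \<in> L2 (cyl S)" using H1 unfolding w_def H1_def by (intro L2_Pair) auto
      have pos: "0 < L2_norm (cyl S) w + 1" by (simp add: add_nonneg_pos)
      have \<delta>: "0 < \<delta>" using neq pos by (simp add: \<delta>_def w_def k_def)
      have "z \<notin> C" if z: "z \<in> HH S" "L2_norm (cyl S) (\<lambda>q. z q - y q) < \<delta>" for z
      proof
        assume "z \<in> C"
        then have "L2_inner (cyl S) z w = k" using C_iff H1 unfolding w_def k_def by blast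
        then have "\<bar>L2_inner (cyl S) y w - k\<bar> = \<bar>L2_inner (cyl S) (\<lambda>q. z q - y q) w\<bar>"
          using L2_inner_diff_left[OF L2[OF z(1)] L2[OF y] w] by simp
        also have "\<dots> \<le> L2_norm (cyl S) (\<lambda>q. z q - y q) * L2_norm (cyl S) w"
          by (intro L2_Cauchy_Schwarz w L2 diff_mem z y)
        also have "\<dots> \<le> \<delta> * L2_norm (cyl S) w" using z(2) by (intro mult_right_mono) auto
        also have "\<dots> < \<delta> * (L2_norm (cyl S) w + 1)" using \<delta> by simp
        also have "\<dots> = \<bar>L2_inner (cyl S) y w - k\<bar>" using pos by (simp add: \<delta>_def)
        finally show False by simp
      qed
      then show ?thesis using \<delta> a False by (intro exI[of _ \<delta>]) auto
    qed
    fix y z and \<theta> :: real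
    assume yz: "y \<in> HH S" "z \<in> HH S" and \<theta>: "0 \<le> \<theta>" "\<theta> \<le> 1"
    define u where "u = (\<lambda>q. (1 - \<theta>) *\<^sub>R y q + \<theta> *\<^sub>R z q)"
    show "(if u \<in> C then 0 else \<infinity>) \<le> ereal (1 - \<theta>) * (if y \<in> C then 0 else \<infinity>) +
        ereal \<theta> * (if z \<in> C then 0 else \<infinity>)"
    proof -
      \<comment> \<open>At the ends, \<open>0 * \<infinity> = 0\<close> in \<open>ereal\<close>
        removes one term, and \<open>u\<close> is the other point. In between, the right-hand side
        is finite only if both points lie in \<open>C\<close>.\<close>
      consider "\<theta> = 0" | "\<theta> = 1" | "0 < \<theta>" "\<theta> < 1" using \<theta> by linarith
      then show ?thesis
      proof cases
        case 3
        have "u \<in> C" if "y \<in> C" "z \<in> C"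
          unfolding C_iff
        proof (intro conjI allI impI)
          show "u \<in> HH S" unfolding u_def by (intro lincomb yz)
          fix \<psi> d g \<psi>0 \<psi>1 assume H1: "H1 S \<psi> d g \<psi>0 \<psi>1"
          then have "(\<lambda>q. (d q, g q)) \<in> L2 (cyl S)" unfolding H1_def by (intro L2_Pair) auto
          then have u: "L2_inner (cyl S) u (\<lambda>q. (d q, g q)) = (1 - \<theta>) * L2_inner (cyl S) y (\<lambda>q. (d q, g q))
              + \<theta> * L2_inner (cyl S) z (\<lambda>q. (d q, g q))"
            unfolding u_def by (intro L2_inner_lincomb_left L2[OF yz(1)] L2[OF yz(2)])
          have yz_eq: "L2_inner (cyl S) y (\<lambda>q. (d q, g q)) = L2_inner (S_area S) \<rho>1 \<psi>1 - L2_inner (S_area S) \<rho>0 \<psi>0"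
            "L2_inner (cyl S) z (\<lambda>q. (d q, g q)) = L2_inner (S_area S) \<rho>1 \<psi>1 - L2_inner (S_area S) \<rho>0 \<psi>0"
            using that H1 unfolding C_iff by blast+
          show "L2_inner (cyl S) u (\<lambda>q. (d q, g q)) =
              L2_inner (S_area S) \<rho>1 \<psi>1 - L2_inner (S_area S) \<rho>0 \<psi>0"
            unfolding u yz_eq by (simp add: algebra_simps)
        qed
        then show ?thesis using 3 by auto
      qed (auto simp: u_def)
    qed
  qed auto
  then show ?thesis by (simp add: C_def)
qed

text \<open>\<open>arg_min\<close> depends only on the predicate of being a minimizer. Minimizing
  the distance over \<open>C\<close> and minimizing the penalized objective over \<open>HH S\<close>
  have the same minimizers, hence the same chosen one.\<close>

lemma proj_is_arg_min:
  assumes S: "closed_surface S" and ne: "CC S \<rho>0 \<rho>1 \<noteq> {}" and z: "z \<in> HH S"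
  shows "is_arg_min (L2_convex.objective (cyl S) (\<lambda>y. if y \<in> CC S \<rho>0 \<rho>1 then 0 else \<infinity>) 1 z)
    (\<lambda>y. y \<in> HH S) (proj S (CC S \<rho>0 \<rho>1) z)"
proof -
  define C where "C = CC S \<rho>0 \<rho>1"
  interpret L2_convex "cyl S" "HH S" "\<lambda>y. if y \<in> C then 0 else \<infinity>"
    unfolding C_def by (rule CC_indicator_convex[OF S ne])
  have CH: "y \<in> HH S" if "y \<in> C" for y using that CC_subset unfolding C_def by blast
  have norm: "normH S (\<lambda>q. z q - y q) = L2_norm (cyl S) (\<lambda>q. y q - z q)" if "y \<in> C" for y
    using normH_eq[OF L2[OF diff_mem[OF z CH[OF that]]]] by (simp only: L2_norm_minus_commute[of _ z y])
  have obj: "objective 1 z y = (if y \<in> C then ereal ((normH S (\<lambda>q. z q - y q))\<^sup>2) else \<infinity>)" for y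
    using norm by (simp add: objective_def)
  have nonneg: "0 \<le> normH S x" for x by (simp add: normH_def)
  obtain c where c: "c \<in> C" using ne by (auto simp: C_def)
  have "is_arg_min (objective 1 z) (\<lambda>y. y \<in> HH S) p \<longleftrightarrow>
      is_arg_min (\<lambda>y. normH S (\<lambda>q. z q - y q)) (\<lambda>y. y \<in> C) p" for p
  proof
    assume p: "is_arg_min (objective 1 z) (\<lambda>y. y \<in> HH S) p"
    then have le: "objective 1 z p \<le> objective 1 z y" if "y \<in> C" for y
      using CH[OF that] by (simp add: is_arg_min_linorder)
    \<comment> \<open>Some point of \<open>C\<close> has finite objective, while points outside
      \<open>C\<close> have objective \<infinity>.\<close>
    have "p \<in> C" using le[OF c] c by (auto simp: obj split: if_splits)
    moreover have "normH S (\<lambda>q. z q - p q) \<le> normH S (\<lambda>q. z q - y q)" if "y \<in> C" for y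
      using le[OF that] that \<open>p \<in> C\<close> nonneg by (simp add: obj power2_le_iff_abs_le abs_of_nonneg)
    ultimately show "is_arg_min (\<lambda>y. normH S (\<lambda>q. z q - y q)) (\<lambda>y. y \<in> C) p"
      by (simp add: is_arg_min_linorder)
  next
    assume p: "is_arg_min (\<lambda>y. normH S (\<lambda>q. z q - y q)) (\<lambda>y. y \<in> C) p"
    then show "is_arg_min (objective 1 z) (\<lambda>y. y \<in> HH S) p"
      using CH nonneg by (auto simp: is_arg_min_linorder obj intro!: power_mono)
  qed
  then have "proj S C z = arg_min (objective 1 z) (\<lambda>y. y \<in> HH S)"
    unfolding proj_def arg_min_def by presburger
  then show ?thesis
    using someI_ex[OF prox_exists[of 1 z]] z by (simp add: arg_min_def C_def)
qed

lemma proj_firmly_nonexpansive: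
  assumes S: "closed_surface S" and ne: "CC S \<rho>0 \<rho>1 \<noteq> {}"
  shows "L2_subspace.firmly_nonexpansive (cyl S) (HH S) (proj S (CC S \<rho>0 \<rho>1))"
proof -
  interpret L2_convex "cyl S" "HH S" "\<lambda>y. if y \<in> CC S \<rho>0 \<rho>1 then 0 else \<infinity>"
    by (rule CC_indicator_convex[OF S ne])
  show ?thesis
    by (intro prox_firmly_nonexpansive[of 1] proj_is_arg_min S ne) auto
qed

section \<open>The lift of discrete states\<close>

lemma Ck_on_imp_continuous_on: "Ck_on k f U \<Longrightarrow> continuous_on U f"
proof (cases k)
  case (Suc j)
  assume "Ck_on k f U"
  then have "f differentiable at x" if "x \<in> U" for x using that Suc by simp
  then show ?thesis
    by (intro continuous_at_imp_continuous_on ballI differentiable_imp_continuous_within)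
qed simp

text \<open>The area density is built from continuous first derivatives of the chart, so it is
  bounded on the compact set \<open>B\<close>, which has finite Lebesgue measure.\<close>

lemma local_param_area_finite:
  assumes S: "closed_surface S" and X: "local_param (S_set S) U X"
    and B: "compact B" "B \<subseteq> U"
  shows "emeasure (S_area S) (X ` B) < \<infinity>"
proof -
  have "Ck_on (Suc 2) X U" using X by (simp add: local_param_def numeral_eq_Suc)
  then have "Ck_on 2 (\<lambda>u. frechet_derivative X (at u) v) U" for v
    by (simp only: Ck_on.simps)
  then have "continuous_on U (\<lambda>u. frechet_derivative X (at u) v)" for v
    by (rule Ck_on_imp_continuous_on)
  then have D: "continuous_on B (\<lambda>u. frechet_derivative X (at u) v)" for v
    using B(2) by (rule continuous_on_subset)
  have "continuous_on B (\<lambda>u. sqrt (det (metric_tensor X u)))"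
    unfolding det_2 metric_tensor_def by (simp, intro continuous_intros D)
  then have "bounded ((\<lambda>u. sqrt (det (metric_tensor X u))) ` B)"
    using B(1) by (intro compact_imp_bounded compact_continuous_image)
  then obtain c where c: "\<And>u. u \<in> B \<Longrightarrow> sqrt (det (metric_tensor X u)) \<le> c"
    unfolding bounded_iff by (auto simp: abs_le_iff)
  have Bb: "B \<in> sets borel" using B(1) by (simp add: borel_compact)
  then have "emeasure (S_area S) (X ` B) =
      (\<integral>\<^sup>+u. indicator B u * ennreal (sqrt (det (metric_tensor X u))) \<partial>lborel)"
    using S X B(2) by (simp add: closed_surface_def)
  also have "\<dots> \<le> (\<integral>\<^sup>+u. ennreal c * indicator B u \<partial>lborel)"
    by (intro nn_integral_mono) (auto simp: indicator_def intro: ennreal_leI c)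
  also have "\<dots> = ennreal c * emeasure lborel B"
    using Bb by (simp add: nn_integral_cmult_indicator)
  also have "\<dots> < \<infinity>"
    using emeasure_bounded_finite[OF compact_imp_bounded[OF B(1)]] by (simp add: ennreal_mult_less_top)
  finally show ?thesis .
qed

lemma finite_measure_S_area:
  assumes S: "closed_surface S"
  shows "finite_measure (S_area S)"
proof
  define M where "M = S_set S"
  have M: "compact M" and sets: "sets (S_area S) = sets (restrict_space borel M)"
    using S unfolding closed_surface_def M_def by blast+
  have meas: "K \<in> sets (S_area S)" if "compact K" "K \<subseteq> M" for K
    using sets_restrict_space_iff[of M borel K] borel_compact[OF M] borel_compact[OF that(1)] that(2)
    by (simp add: sets)
  have charts: "\<forall>x\<in>M. \<exists>U X. local_param M U X \<and> x \<in> X ` U"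
    using S unfolding closed_surface_def M_def by (elim conjE)
  \<comment> \<open>Two roles are separated: \<open>V\<close> is the image of an open ball and
    serves the cover, \<open>K\<close> is the image of the closed ball, compact and hence measurable
    with finite area.\<close>
  define \<C> where "\<C> = {V. openin (top_of_set M) V \<and> (\<exists>K. V \<subseteq> K \<and> K \<in> sets (S_area S) \<and> emeasure (S_area S) K < \<infinity>)}"
  have "M \<subseteq> \<Union>\<C>"
  proof
    fix x assume x: "x \<in> M"
    then obtain U X where X: "local_param M U X" and "x \<in> X ` U"
      using charts by blast
    then obtain u where u: "u \<in> U" "x = X u" by blast
    have "open U" and cont: "continuous_on U X" and XU: "openin (top_of_set M) (X ` U)"
      using X Ck_on_imp_continuous_on unfolding local_param_def by blast+
    then obtain r where r: "0 < r" "cball u r \<subseteq> U" using u(1) open_contains_cball by blast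
    obtain Z where "homeomorphism U (X ` U) X Z"
      using X unfolding local_param_def by blast
    then have "openin (top_of_set (X ` U)) (X ` ball u r)"
      using r ball_subset_cball by (elim homeomorphism_imp_open_map) (auto simp: openin_open_eq[OF \<open>open U\<close>])
    then have "openin (top_of_set M) (X ` ball u r)" using XU by (rule openin_trans)
    moreover have "X ` ball u r \<subseteq> X ` cball u r" by auto
    moreover have "X ` cball u r \<in> sets (S_area S)"
      using r XU by (intro meas compact_continuous_image continuous_on_subset[OF cont])
        (auto dest: openin_imp_subset)
    moreover have "emeasure (S_area S) (X ` cball u r) < \<infinity>"
      using local_param_area_finite[OF S] X r(2) by (simp add: M_def)
    ultimately have "X ` ball u r \<in> \<C>" unfolding \<C>_def by blast
    moreover have "x \<in> X ` ball u r" using u(2) r(1) by simp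
    ultimately show "x \<in> \<Union>\<C>" by blast
  qed
  moreover have "\<forall>V\<in>\<C>. openin (top_of_set M) V" by (simp add: \<C>_def)
  ultimately obtain \<D> where \<D>: "\<D> \<subseteq> \<C>" "finite \<D>" "M \<subseteq> \<Union>\<D>"
    using M unfolding compact_eq_openin_cover by metis
  then have "\<forall>V\<in>\<D>. \<exists>K. V \<subseteq> K \<and> K \<in> sets (S_area S) \<and> emeasure (S_area S) K < \<infinity>"
    by (auto simp: \<C>_def)
  then obtain K where K: "\<And>V. V \<in> \<D> \<Longrightarrow> V \<subseteq> K V" "\<And>V. V \<in> \<D> \<Longrightarrow> K V \<in> sets (S_area S)"
    "\<And>V. V \<in> \<D> \<Longrightarrow> emeasure (S_area S) (K V) < \<infinity>" by metis
  have "emeasure (S_area S) M \<le> emeasure (S_area S) (\<Union>V\<in>\<D>. K V)"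
    using \<D> K by (intro emeasure_mono) (auto, blast)
  also have "\<dots> \<le> (\<Sum>V\<in>\<D>. emeasure (S_area S) (K V))"
    using \<D>(2) K(2) by (intro emeasure_subadditive_finite) auto
  also have "\<dots> < \<infinity>" using K(3) \<D>(2) by simp
  finally show "emeasure (S_area S) (space (S_area S)) \<noteq> \<infinity>"
    by (simp add: space_S_area[OF S] M_def)
qed

lemma finite_measure_cyl:
  assumes S: "closed_surface S"
  shows "finite_measure (cyl S)"
proof
  interpret finite_measure "S_area S" by (rule finite_measure_S_area[OF S])
  have "emeasure (cyl S) (space (cyl S)) =
      emeasure (restrict_space lborel {0<..<1::real}) {0<..<1} * emeasure (S_area S) (space (S_area S))"
    unfolding cyl_def space_pair_measure
    by (subst emeasure_pair_measure_Times) (auto simp: space_restrict_space sets_restrict_space_iff)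
  also have "emeasure (restrict_space lborel {0<..<1::real}) {0<..<1} = 1"
    by (subst emeasure_restrict_space) auto
  finally show "emeasure (cyl S) (space (cyl S)) \<noteq> \<infinity>"
    by simp
qed

lemma L2_bounded:
  fixes f :: "'a \<Rightarrow> 'b::euclidean_space"
  assumes "finite_measure N" "f \<in> borel_measurable N" "\<And>x. x \<in> space N \<Longrightarrow> norm (f x) \<le> c"
  shows "f \<in> L2 N"
proof -
  interpret finite_measure N by fact
  have "norm ((norm (f x))\<^sup>2) \<le> c\<^sup>2" if "x \<in> space N" for x
    using power_mono[OF assms(3)[OF that], of 2] by simp
  then have "integrable N (\<lambda>x. (norm (f x))\<^sup>2)"
    using assms(2) by (intro integrable_const_bound[of _ "c\<^sup>2"]) auto
  then show ?thesis using assms(2) by (simp add: L2_def)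
qed

section \<open>Barycentric coordinates and nodal basis functions\<close>

lemma affine_coordinates_unique:
  fixes V :: "'v::finite \<Rightarrow> 'b::real_vector" and l l' :: "'v \<Rightarrow> real"
  assumes V: "inj V" "\<not> affine_dependent (V ` C)"
    and supp: "\<And>i. i \<notin> C \<Longrightarrow> l i = 0" "\<And>i. i \<notin> C \<Longrightarrow> l' i = 0"
    and eq: "sum l UNIV = sum l' UNIV" "(\<Sum>i\<in>UNIV. l i *\<^sub>R V i) = (\<Sum>i\<in>UNIV. l' i *\<^sub>R V i)"
  shows "l = l'"
proof
  fix i
  define m where "m i = l i - l' i" for i
  \<comment> \<open>Affine dependence concerns sets of points while coordinates are indexed by
    vertices; \<open>inv V\<close> transports the coefficients.\<close>
  define U where "U v = m (inv V v)" for v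
  have inj: "inj_on V C" using V(1) by (rule inj_on_subset) simp
  have UV: "U (V i) = m i" for i using V(1) by (simp add: U_def)
  have m0: "m i = 0" if "i \<notin> C" for i using supp that by (simp add: m_def)
  have "sum U (V ` C) = sum m C" by (simp add: sum.reindex[OF inj] UV)
  also have "\<dots> = sum m UNIV" by (rule sum.mono_neutral_left) (auto simp: m0)
  also have "\<dots> = 0" using eq(1) by (simp add: m_def sum_subtractf)
  finally have 1: "sum U (V ` C) = 0" .
  have "(\<Sum>v\<in>V ` C. U v *\<^sub>R v) = (\<Sum>i\<in>C. m i *\<^sub>R V i)" by (simp add: sum.reindex[OF inj] UV)
  also have "\<dots> = (\<Sum>i\<in>UNIV. m i *\<^sub>R V i)" by (rule sum.mono_neutral_left) (auto simp: m0)
  also have "\<dots> = 0" using eq(2) by (simp add: m_def scaleR_diff_left sum_subtractf)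
  finally have "(\<Sum>v\<in>V ` C. U v *\<^sub>R v) = 0" .
  with 1 V(2) have "\<forall>v\<in>V ` C. U v = 0" by (auto simp: affine_dependent_explicit_finite)
  then have "m i = 0" using m0 UV by (cases "i \<in> C") auto
  then show "l i = l' i" by (simp add: m_def)
qed

lemma convex_hull_image_coordinates:
  fixes V :: "'v::finite \<Rightarrow> 'b::real_vector"
  assumes V: "inj V" and x: "x \<in> convex hull (V ` C)"
  obtains l where "\<And>i. 0 \<le> l i" "\<And>i. i \<notin> C \<Longrightarrow> l i = 0" "sum l UNIV = 1"
    "(\<Sum>i\<in>UNIV. l i *\<^sub>R V i) = x"
proof -
  have inj: "inj_on V C" using V by (rule inj_on_subset) simp
  obtain u where u: "\<forall>v\<in>V ` C. 0 \<le> u v" "sum u (V ` C) = 1" "(\<Sum>v\<in>V ` C. u v *\<^sub>R v) = x"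
    using x by (auto simp: convex_hull_finite)
  define l where "l i = (if i \<in> C then u (V i) else 0)" for i
  show ?thesis
  proof (rule that[of l])
    have "sum l UNIV = sum l C" by (rule sum.mono_neutral_right) (auto simp: l_def)
    then show "sum l UNIV = 1" using u(2) by (simp add: sum.reindex[OF inj] l_def)
    have "(\<Sum>i\<in>UNIV. l i *\<^sub>R V i) = (\<Sum>i\<in>C. l i *\<^sub>R V i)"
      by (rule sum.mono_neutral_right) (auto simp: l_def)
    then show "(\<Sum>i\<in>UNIV. l i *\<^sub>R V i) = x" using u(3) by (simp add: sum.reindex[OF inj] l_def)
  qed (use u(1) in \<open>auto simp: l_def\<close>)
qed

lemma coordinates_in_convex_hull:
  fixes V :: "'v::finite \<Rightarrow> 'b::real_vector" and l :: "'v \<Rightarrow> real"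
  assumes "\<And>i. 0 \<le> l i" "\<And>i. i \<notin> C \<Longrightarrow> l i = 0" "sum l UNIV = 1"
  shows "(\<Sum>i\<in>UNIV. l i *\<^sub>R V i) \<in> convex hull (V ` C)"
proof -
  have "sum l C = 1" using sum.mono_neutral_left[of UNIV C l] assms by simp
  then have "(\<Sum>i\<in>C. l i *\<^sub>R V i) \<in> convex hull (V ` C)"
    using assms(1) by (intro convex_sum) (auto simp: hull_inc)
  also have "(\<Sum>i\<in>C. l i *\<^sub>R V i) = (\<Sum>i\<in>UNIV. l i *\<^sub>R V i)"
    using assms(2) by (intro sum.mono_neutral_left) auto
  finally show ?thesis .
qed

text \<open>On a point shared by two triangles the coordinates with respect to either one agree with
  those with respect to the common face.\<close>

lemma barycentric_unique:
  fixes D :: "'v::finite discretization" and l l' :: "'v \<Rightarrow> real"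
  assumes D: "triangulated D" and K: "K \<in> D_tri D" "K' \<in> D_tri D"
    and l: "\<And>i. 0 \<le> l i" "\<And>i. i \<notin> corners K \<Longrightarrow> l i = 0" "sum l UNIV = 1"
    and l': "\<And>i. 0 \<le> l' i" "\<And>i. i \<notin> corners K' \<Longrightarrow> l' i = 0" "sum l' UNIV = 1"
    and eq: "(\<Sum>i\<in>UNIV. l i *\<^sub>R D_vert D i) = (\<Sum>i\<in>UNIV. l' i *\<^sub>R D_vert D i)"
  shows "l = l'"
proof -
  have V: "inj (D_vert D)" and ind: "\<not> affine_dependent (D_vert D ` corners K)"
    "\<not> affine_dependent (D_vert D ` corners K')"
    and face: "cell D K \<inter> cell D K' = convex hull (D_vert D ` (corners K \<inter> corners K'))"
    using D K unfolding triangulated_def by blast+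
  define x where "x = (\<Sum>i\<in>UNIV. l i *\<^sub>R D_vert D i)"
  have "x \<in> cell D K" "x \<in> cell D K'"
    using coordinates_in_convex_hull[of l "corners K" "D_vert D"]
      coordinates_in_convex_hull[of l' "corners K'" "D_vert D"] l l' eq
    by (auto simp: x_def cell_def)
  then have "x \<in> convex hull (D_vert D ` (corners K \<inter> corners K'))" using face by blast
  then obtain k where k: "\<And>i. i \<notin> corners K \<inter> corners K' \<Longrightarrow> k i = 0" "sum k UNIV = 1"
    "(\<Sum>i\<in>UNIV. k i *\<^sub>R D_vert D i) = x"
    using convex_hull_image_coordinates[OF V] by metis
  have "l = k"
    by (rule affine_coordinates_unique[OF V ind(1)]) (use l k x_def in auto)
  moreover have "l' = k"
    by (rule affine_coordinates_unique[OF V ind(2)]) (use l' k eq x_def in auto)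
  ultimately show ?thesis by simp
qed

text \<open>Barycentric coordinates invert a continuous injection defined on a compact union of
  simplices, one in \<open>real^'v\<close> for each triangle.\<close>

lemma hat_continuous_bounded:
  fixes D :: "'v::finite discretization"
  assumes D: "triangulated D"
  shows "continuous_on (mesh_set D) (hat D i)" and "x \<in> mesh_set D \<Longrightarrow> \<bar>hat D i x\<bar> \<le> 1"
proof -
  \<comment> \<open>Setting coordinates off the corners to 0 places all simplices in one space, so
    that their union is compact and no gluing of continuity across edges is required.\<close>
  define \<Delta> where "\<Delta> K = {l::real^'v. (\<forall>i. 0 \<le> l $ i) \<and> (\<forall>i. i \<notin> corners K \<longrightarrow> l $ i = 0) \<and>
    (\<Sum>i\<in>UNIV. l $ i) = 1}" for K :: "'v \<times> 'v \<times> 'v"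
  define F where "F l = (\<Sum>i\<in>UNIV. l $ i *\<^sub>R D_vert D i)" for l :: "real^'v"
  define T where "T = (\<Union>K\<in>D_tri D. \<Delta> K)"
  have le1: "l $ i \<le> 1" if "l \<in> \<Delta> K" for l K i
    using member_le_sum[of i UNIV "($) l"] that by (auto simp: \<Delta>_def)
  have "compact (\<Delta> K)" for K
  proof -
    have "\<Delta> K \<subseteq> cbox 0 1"
      using le1[of _ K] by (intro subsetI, unfold mem_box_cart) (simp add: \<Delta>_def)
    then have "bounded (\<Delta> K)" using bounded_cbox bounded_subset by blast
    moreover have "closed (\<Delta> K)"
      unfolding \<Delta>_def
      by (intro closed_Collect_conj closed_Collect_all closed_Collect_imp open_Collect_const
          closed_Collect_le closed_Collect_eq continuous_intros)
    ultimately show ?thesis by (simp add: compact_eq_bounded_closed)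
  qed
  then have "compact T" unfolding T_def by (intro compact_UN) auto
  moreover have "continuous_on T F" unfolding F_def by (intro continuous_intros)
  moreover have inj: "inj_on F T"
  proof (rule inj_onI)
    fix l l' assume "l \<in> T" "l' \<in> T" and eq: "F l = F l'"
    then obtain K K' where "K \<in> D_tri D" "K' \<in> D_tri D" "l \<in> \<Delta> K" "l' \<in> \<Delta> K'"
      unfolding T_def by blast
    then have "($) l = ($) l'"
      using eq by (intro barycentric_unique[OF D, of K K']) (auto simp: \<Delta>_def F_def)
    then show "l = l'" by (simp add: vec_eq_iff)
  qed
  ultimately obtain g where g: "homeomorphism T (F ` T) F g"
    using homeomorphism_compact[of T F] by blast
  \<comment> \<open>The definite description in \<open>bary\<close> is meaningful since coordinates
    from any two triangles containing the point agree.\<close>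
  have bary: "bary D (F l) = ($) l" if lT: "l \<in> T" for l
    unfolding bary_def
  proof (rule the_equality)
    obtain K where K: "K \<in> D_tri D" "l \<in> \<Delta> K" using lT unfolding T_def by blast
    then show "(\<forall>i. 0 \<le> l $ i) \<and> (\<exists>K\<in>D_tri D. \<forall>i. i \<notin> corners K \<longrightarrow> l $ i = 0) \<and>
        (\<Sum>i\<in>UNIV. l $ i) = 1 \<and> (\<Sum>i\<in>UNIV. l $ i *\<^sub>R D_vert D i) = F l"
      by (auto simp: \<Delta>_def F_def)
    fix l' assume l': "(\<forall>i. 0 \<le> l' i) \<and> (\<exists>K\<in>D_tri D. \<forall>i. i \<notin> corners K \<longrightarrow> l' i = 0) \<and>
        (\<Sum>i\<in>UNIV. l' i) = 1 \<and> (\<Sum>i\<in>UNIV. l' i *\<^sub>R D_vert D i) = F l"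
    then obtain K' where "K' \<in> D_tri D" "\<And>i. i \<notin> corners K' \<Longrightarrow> l' i = 0" by blast
    then show "l' = ($) l"
      using l' K by (intro barycentric_unique[OF D, of K' K]) (auto simp: \<Delta>_def F_def)
  qed
  have sub: "mesh_set D \<subseteq> F ` T"
  proof
    fix y assume "y \<in> mesh_set D"
    then obtain K where K: "K \<in> D_tri D" "y \<in> convex hull (D_vert D ` corners K)"
      by (auto simp: mesh_set_def cell_def)
    have inj: "inj (D_vert D)" using D by (simp add: triangulated_def)
    obtain l where l: "\<And>i. 0 \<le> l i" "\<And>i. i \<notin> corners K \<Longrightarrow> l i = 0" "sum l UNIV = 1"
      "(\<Sum>i\<in>UNIV. l i *\<^sub>R D_vert D i) = y"
      using convex_hull_image_coordinates[OF inj K(2)] by blast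
    then have "y = F (\<chi> i. l i)" "(\<chi> i. l i) \<in> T"
      using K(1) by (auto simp: F_def T_def \<Delta>_def)
    then show "y \<in> F ` T" by blast
  qed
  have hat: "hat D i (F l) = l $ i" if "l \<in> T" for l i using bary[OF that] by (simp add: hat_def)
  show "\<bar>hat D i x\<bar> \<le> 1" if x: "x \<in> mesh_set D"
  proof -
    obtain l where l: "l \<in> T" "x = F l" using x sub by blast
    then obtain K where "l \<in> \<Delta> K" unfolding T_def by blast
    then have "0 \<le> l $ i" "l $ i \<le> 1" using le1 by (simp add: \<Delta>_def, blast)
    then show ?thesis using hat[OF \<open>l \<in> T\<close>] \<open>x = F l\<close> by simp
  qed
  have "continuous_on (F ` T) (\<lambda>x. g x $ i)"
    using g by (intro continuous_intros) (simp add: homeomorphism_def)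
  moreover have "g x $ i = hat D i x" if "x \<in> F ` T" for x
    using that hat g by (auto simp: homeomorphism_def)
  ultimately have "continuous_on (F ` T) (hat D i)" by (simp cong: continuous_on_cong)
  then show "continuous_on (mesh_set D) (hat D i)" using sub by (rule continuous_on_subset)
qed

section \<open>Square integrability and linearity of the lift\<close>

lemma time_hat_bounded: "\<bar>time_hat D j t\<bar> \<le> 1"
  by (auto simp: time_hat_def tau_def)

lemma time_hat_measurable: "time_hat D j \<in> borel_measurable borel"
  unfolding time_hat_def by measurable

lemma norm_tan_proj_le:
  assumes "closed_surface S" "x \<in> S_set S"
  shows "norm (tan_proj S x v) \<le> 2 * norm v"
proof -
  have "norm (tan_proj S x v) \<le> norm v + \<bar>v \<bullet> S_nu S x\<bar> * norm (S_nu S x)"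
    unfolding tan_proj_def by (rule order_trans[OF norm_triangle_ineq4]) simp
  also have "\<dots> \<le> 2 * norm v"
    using Cauchy_Schwarz_ineq2[of v "S_nu S x"] norm_S_nu[OF assms] by simp
  finally show ?thesis .
qed

lemma tan_proj_orthogonal:
  assumes "closed_surface S" "x \<in> S_set S"
  shows "tan_proj S x v \<bullet> S_nu S x = 0"
  using norm_S_nu[OF assms] by (simp add: tan_proj_def inner_diff_left dot_square_norm)

text \<open>On a space of finite measure a bounded measurable function is square-integrable. All
  basis functions are at most 1 in modulus, so the nodal values give the bound.\<close>

lemma eval_h_L2:
  fixes D :: "'v::finite discretization" and u :: "nat \<Rightarrow> 'v \<Rightarrow> 'b::euclidean_space"
  assumes S: "closed_surface S" and D: "triangulated D" "correspondence S D"
  shows "(\<lambda>q. eval_h D u (fst q, the_inv_into (mesh_set D) (D_ph D) (snd q))) \<in> L2 (cyl S)"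
proof -
  define p where "p = the_inv_into (mesh_set D) (D_ph D)"
  have "bij_betw p (S_set S) (mesh_set D)"
    unfolding p_def using D(2) by (intro bij_betw_the_inv_into) (simp add: correspondence_def)
  then have p_mem: "p x \<in> mesh_set D" if "x \<in> S_set S" for x using that bij_betwE by blast
  \<comment> \<open>The basis functions are continuous on the mesh only, so measurability is
    composed through the Borel space restricted to it.\<close>
  have "p \<in> S_area S \<rightarrow>\<^sub>M restrict_space borel (mesh_set D)"
    using D(2) p_mem by (intro measurable_restrict_space2) (auto simp: correspondence_def p_def space_S_area[OF S])
  moreover have "hat D i \<in> borel_measurable (restrict_space borel (mesh_set D))" for i
    by (intro borel_measurable_continuous_on_restrict hat_continuous_bounded D)
  ultimately have hat_p: "(\<lambda>x. hat D i (p x)) \<in> borel_measurable (S_area S)" for i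
    by (rule measurable_compose)
  have [measurable]: "(\<lambda>q. hat D i (p (snd q))) \<in> borel_measurable (cyl S)"
    "(\<lambda>q. time_hat D j (fst q)) \<in> borel_measurable (cyl S)" for i j
    using measurable_compose[OF snd_cyl_measurable hat_p]
      measurable_compose[OF fst_cyl_measurable time_hat_measurable] by auto
  show ?thesis
    unfolding p_def[symmetric]
  proof (rule L2_bounded[OF finite_measure_cyl[OF S]])
    show "(\<lambda>q. eval_h D u (fst q, p (snd q))) \<in> borel_measurable (cyl S)"
      unfolding eval_h_def interp_def fst_conv snd_conv by measurable
    fix q assume "q \<in> space (cyl S)"
    then have "p (snd q) \<in> mesh_set D" using p_mem by (auto simp: space_cyl[OF S])
    then have hat: "\<bar>hat D i (p (snd q))\<bar> \<le> 1" for i by (intro hat_continuous_bounded D)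
    have "norm (interp D (u j) (p (snd q))) \<le> (\<Sum>i\<in>UNIV. norm (u j i))" for j
      unfolding interp_def using hat
      by (intro sum_norm_le) (simp add: mult_left_le_one_le)
    then have "norm (time_hat D j (fst q) *\<^sub>R interp D (u j) (p (snd q))) \<le> 1 * (\<Sum>i\<in>UNIV. norm (u j i))" for j
      unfolding norm_scaleR using time_hat_bounded by (intro mult_mono) auto
    then show "norm (eval_h D u (fst q, p (snd q))) \<le> (\<Sum>j\<le>D_steps D. 1 * (\<Sum>i\<in>UNIV. norm (u j i)))"
      unfolding eval_h_def fst_conv snd_conv by (intro sum_norm_le)
  qed
qed

text \<open>Tangency comes from the final pointwise projection, which at most doubles norms by the
  crude estimate above; hence the factor 4 for squares.\<close>

lemma Jh_in_HH:
  fixes D :: "'v::finite discretization"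
  assumes S: "closed_surface S" and D: "triangulated D" "correspondence S D"
  shows "Jh S D z \<in> HH S"
proof -
  define e where "e q = eval_h D (\<lambda>j i. snd (z j i)) (fst q, the_inv_into (mesh_set D) (D_ph D) (snd q))" for q
  have e: "e \<in> L2 (cyl S)" unfolding e_def by (rule eval_h_L2[OF S D])
  have [measurable]: "(\<lambda>q. S_nu S (snd q)) \<in> borel_measurable (cyl S)" "e \<in> borel_measurable (cyl S)"
    using measurable_compose[OF snd_cyl_measurable S_nu_measurable[OF S]] e by (auto simp: L2_def)
  have snd_meas: "(\<lambda>q. tan_proj S (snd q) (e q)) \<in> borel_measurable (cyl S)"
    unfolding tan_proj_def by measurable
  have "integrable (cyl S) (\<lambda>q. (norm (tan_proj S (snd q) (e q)))\<^sup>2)"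
  proof (rule Bochner_Integration.integrable_bound)
    show "integrable (cyl S) (\<lambda>q. 4 * (norm (e q))\<^sup>2)" using L2_integrable[OF e] by simp
    show "(\<lambda>q. (norm (tan_proj S (snd q) (e q)))\<^sup>2) \<in> borel_measurable (cyl S)"
      using snd_meas by measurable
    show "AE q in cyl S. norm ((norm (tan_proj S (snd q) (e q)))\<^sup>2) \<le> norm (4 * (norm (e q))\<^sup>2)"
    proof (rule AE_I2)
      fix q assume "q \<in> space (cyl S)"
      then have "norm (tan_proj S (snd q) (e q)) \<le> 2 * norm (e q)"
        by (intro norm_tan_proj_le[OF S]) (auto simp: space_cyl[OF S])
      from power_mono[OF this, of 2]
      show "norm ((norm (tan_proj S (snd q) (e q)))\<^sup>2) \<le> norm (4 * (norm (e q))\<^sup>2)"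
        by (simp add: power_mult_distrib)
    qed
  qed
  then have "(\<lambda>q. tan_proj S (snd q) (e q)) \<in> L2 (cyl S)" using snd_meas by (simp add: L2_def)
  moreover have "snd \<circ> Jh S D z = (\<lambda>q. tan_proj S (snd q) (e q))"
    by (simp add: fun_eq_iff Jh_def e_def Let_def)
  moreover have "fst \<circ> Jh S D z \<in> L2 (cyl S)"
    using eval_h_L2[OF S D, of "\<lambda>j i. fst (z j i)"] by (simp add: Jh_def comp_def Let_def)
  moreover have "tangential S (\<lambda>q. tan_proj S (snd q) (e q))"
    unfolding tangential_def
    by (intro AE_I2 tan_proj_orthogonal[OF S]) (auto simp: space_cyl[OF S])
  ultimately show ?thesis by (simp add: HH_def)
qed

lemma eval_h_lincomb:
  "eval_h D (\<lambda>j i. a *\<^sub>R u j i + b *\<^sub>R w j i) q = a *\<^sub>R eval_h D u q + b *\<^sub>R eval_h D w q"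
  by (simp add: eval_h_def interp_def scaleR_sum_right sum.distrib scaleR_add_right mult_ac)

text \<open>Linearity is what turns the discrete reflection and update into the same formulas for
  lifted states.\<close>

lemma Jh_lincomb:
  "Jh S D (\<lambda>j i. a *\<^sub>R z j i + b *\<^sub>R w j i) q = a *\<^sub>R Jh S D z q + b *\<^sub>R Jh S D w q"
  using eval_h_lincomb[of D a "\<lambda>j i. fst (z j i)" b "\<lambda>j i. fst (w j i)"]
    eval_h_lincomb[of D a "\<lambda>j i. snd (z j i)" b "\<lambda>j i. snd (w j i)"]
  by (simp add: Jh_def Let_def tan_proj_def inner_add_left algebra_simps)

section \<open>Error propagation\<close>

theorem theorem5p2:
  fixes S :: surface and \<rho>0 \<rho>1 :: "R3 \<Rightarrow> real"
    and Y :: "state \<Rightarrow> ereal" and \<gamma> \<alpha> \<kappa> :: real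
    and D :: "'v::finite discretization"
    and L :: "real \<Rightarrow> R3 \<Rightarrow> ereal" and E :: "'v scalar_h \<Rightarrow> ereal"
    and \<Phi> :: "'v state_h \<Rightarrow> 'v scalar_h" and resid :: "'v state_h \<Rightarrow> 'v scalar_h \<Rightarrow> real"
    and Q_hat :: "'v state_h \<Rightarrow> 'v state_h" and errQ :: "'v state_h \<Rightarrow> 'v state_h"
    and zbar z :: "nat \<Rightarrow> state" and zbar_h z_h v_h :: "nat \<Rightarrow> 'v state_h"
    and \<pi>_h q_h ebar :: "nat \<Rightarrow> real"
  defines "P \<equiv> proj S (CC S \<rho>0 \<rho>1)" and "Q \<equiv> prox S \<gamma> Y"
  assumes surface: "closed_surface S"
    and endpoints: "endpoint_density S \<rho>0" "endpoint_density S \<rho>1"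
    and nonempty: "CC S \<rho>0 \<rho>1 \<noteq> {}"
    and Y: "properH S Y" "lscH S Y" "convexH S Y"
    and params: "0 < \<gamma>" "0 < \<alpha>" "\<alpha> < 2"
    and mesh: "triangulated D" "connected (mesh_set D)" "shape_regular \<kappa> D" "correspondence S D"
    and steps: "2 \<le> D_steps D"
    and recovery: "recovery_data D"
    and endpoints_h: "unit_mass D (D_rho0 D)" "unit_mass D (D_rho1 D)"
    and solver: "\<And>v. v \<in> Xh D \<Longrightarrow> \<Phi> v \<in> Vh D \<and>
          (\<forall>w\<in>Vh D. a_h D (\<Phi> v) w = ell_h D v w + resid v w)"
    and prox_h: "\<And>v. v \<in> Xh D \<Longrightarrow> Q_hat v \<in> Xh D \<and>
          Q_hat v = (\<lambda>j i. prox_h D \<gamma> (energy_h D L E) v j i + errQ v j i)"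
    and exact: "\<And>k. zbar k \<in> HH S" "\<And>k. z k \<in> HH S"
          "\<And>k. eqH S (zbar (Suc k)) (DR_step \<alpha> P Q (zbar k))"
          "\<And>k. eqH S (z k) (P (zbar k))"
    and discrete: "zbar_h 0 \<in> Xh D"
          "\<And>k. z_h k = P_hat D \<Phi> (zbar_h k)"
          "\<And>k. v_h k = (\<lambda>j i. 2 *\<^sub>R z_h k j i - zbar_h k j i)"
          "\<And>k. zbar_h (Suc k) = (\<lambda>j i. zbar_h k j i + \<alpha> *\<^sub>R (Q_hat (v_h k) j i - z_h k j i))"
    and defects:
          "\<And>k. \<pi>_h k = normH S (\<lambda>q. Jh S D (P_hat D \<Phi> (zbar_h k)) q - P (Jh S D (zbar_h k)) q)"
          "\<And>k. q_h k = normH S (\<lambda>q. Jh S D (Q_hat (v_h k)) q - Q (Jh S D (v_h k)) q)"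
    and ebar: "\<And>k. ebar k = normH S (\<lambda>q. zbar k q - Jh S D (zbar_h k) q)"
  shows "\<forall>K. ebar K \<le> ebar 0 + \<alpha> * (\<Sum>k<K. 3 * \<pi>_h k + q_h k) \<and>
             normH S (\<lambda>q. z K q - Jh S D (z_h K) q) \<le> ebar K + \<pi>_h K"
proof -
  interpret L2_subspace "cyl S" "HH S" by (rule HH_subspace[OF surface])
  have P: "firmly_nonexpansive P"
    unfolding P_def by (rule proj_firmly_nonexpansive[OF surface nonempty])
  have Q: "firmly_nonexpansive Q"
    unfolding Q_def by (rule prox_firmly_nonexpansive_HH[OF surface L2_convexI[OF surface Y] params(1)])
  have J: "Jh S D w \<in> HH S" for w by (rule Jh_in_HH[OF surface mesh(1,4)])
  define x p y where "x k = Jh S D (zbar_h k)" and "p k = Jh S D (z_h k)"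
    and "y k = Jh S D (Q_hat (v_h k))" for k
  have H: "x k \<in> HH S" "p k \<in> HH S" "y k \<in> HH S" for k
    unfolding x_def p_def y_def by (rule J)+
  have norm: "normH S (\<lambda>q. a q - b q) = L2_norm (cyl S) (\<lambda>q. a q - b q)" if "a \<in> HH S" "b \<in> HH S" for a b
    by (intro normH_eq L2 diff_mem that)
  have v: "Jh S D (v_h k) = (\<lambda>q. 2 *\<^sub>R p k q - x k q)" for k
    using Jh_lincomb[of S D 2 "z_h k" "-1" "zbar_h k"] by (simp add: discrete(3) p_def x_def fun_eq_iff)
  have x_Suc: "x (Suc k) = (\<lambda>q. x k q + \<alpha> *\<^sub>R (y k q - p k q))" for k
  proof
    fix q
    have "x (Suc k) q = 1 *\<^sub>R x k q + \<alpha> *\<^sub>R Jh S D (\<lambda>j i. 1 *\<^sub>R Q_hat (v_h k) j i + (-1) *\<^sub>R z_h k j i) q"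
      unfolding x_def Jh_lincomb[symmetric] by (simp add: discrete(4))
    also have "\<dots> = x k q + \<alpha> *\<^sub>R (y k q - p k q)"
      unfolding Jh_lincomb y_def p_def by simp
    finally show "x (Suc k) q = x k q + \<alpha> *\<^sub>R (y k q - p k q)" .
  qed
  have Px: "P (x k) \<in> HH S" and Qv: "Q (\<lambda>q. 2 *\<^sub>R p k q - x k q) \<in> HH S"
    and Pz: "P (zbar k) \<in> HH S" for k
    by (intro firmly_nonexpansive_mem[OF P] firmly_nonexpansive_mem[OF Q] mem H exact(1))+
  have \<pi>: "\<pi>_h k = L2_norm (cyl S) (\<lambda>q. p k q - P (x k) q)" for k
    using norm[OF H(2) Px] defects(1)[of k] by (simp add: p_def x_def discrete(2))
  have q: "q_h k = L2_norm (cyl S) (\<lambda>q. y k q - Q (\<lambda>q. 2 *\<^sub>R p k q - x k q) q)" for k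
    using norm[OF H(3) Qv] defects(2)[of k] by (simp add: y_def v)
  have e: "ebar k = L2_norm (cyl S) (\<lambda>q. zbar k q - x k q)" for k
    using norm[OF exact(1) H(1)] ebar[of k] by (simp add: x_def)
  have step: "ebar (Suc k) \<le> ebar k + \<alpha> * (3 * \<pi>_h k + q_h k)" for k
  proof -
    have T: "DR_step \<alpha> P Q (zbar k) \<in> HH S"
      unfolding DR_step_def
      by (intro mem firmly_nonexpansive_mem[OF Q] Pz exact(1))
    \<comment> \<open>The exact recursion holds only almost everywhere, so it is substituted under
      the norm.\<close>
    have "ebar (Suc k) = L2_norm (cyl S) (\<lambda>q. DR_step \<alpha> P Q (zbar k) q - x (Suc k) q)"
      unfolding e
    proof (rule L2_norm_cong_AE)
      show "AE q in cyl S. zbar (Suc k) q - x (Suc k) q = DR_step \<alpha> P Q (zbar k) q - x (Suc k) q"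
        using exact(3)[of k] by (auto simp: eqH_def)
    qed (intro L2_measurable L2 diff_mem exact(1) H T)+
    also have "\<dots> \<le> ebar k + \<alpha> * (3 * \<pi>_h k + q_h k)"
      unfolding DR_step_def x_Suc e \<pi> q
      by (rule perturbed_Douglas_Rachford_step[OF P Q params(2,3) exact(1) H])
    finally show ?thesis .
  qed
  have "ebar K \<le> ebar 0 + \<alpha> * (\<Sum>k<K. 3 * \<pi>_h k + q_h k)" for K
  proof (induction K)
    case (Suc K)
    then show ?case using step[of K] by (simp add: distrib_left)
  qed simp
  moreover have "normH S (\<lambda>q. z K q - Jh S D (z_h K) q) \<le> ebar K + \<pi>_h K" for K
  proof -
    have "normH S (\<lambda>q. z K q - p K q) = L2_norm (cyl S) (\<lambda>q. P (zbar K) q - p K q)"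
      unfolding norm[OF exact(2) H(2)]
    proof (rule L2_norm_cong_AE)
      show "AE q in cyl S. z K q - p K q = P (zbar K) q - p K q"
        using exact(4)[of K] by (auto simp: eqH_def)
    qed (intro L2_measurable L2 diff_mem exact(2) H Pz)+
    \<comment> \<open>Through \<open>P (x K)\<close>: the first distance is bounded because
      \<open>P\<close> is 1-Lipschitz, the second is the projection defect itself.\<close>
    also have "\<dots> \<le> L2_norm (cyl S) (\<lambda>q. P (zbar K) q - P (x K) q) + L2_norm (cyl S) (\<lambda>q. P (x K) q - p K q)"
      by (intro L2_norm_triangle_diff L2 Pz Px H)
    also have "\<dots> \<le> ebar K + \<pi>_h K"
      unfolding e \<pi> L2_norm_minus_commute[of _ "p K"]
      by (intro add_right_mono firmly_nonexpansive_lipschitz[OF P exact(1) H(1)])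
    finally show ?thesis by (simp add: p_def)
  qed
  ultimately show ?thesis by blast
qed

end
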